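(* Let $n=n_d\ge1$, $1\le s=s_d\le d$, $\alpha=\alpha_d\in(0,1]$ depend on $d$, and assume that, as $d\to\infty$, $n\alpha^2/d\to+\infty$ with $n\alpha^2/d\gg\log(d)$. Set $$a^*=a^*_d=\frac{\sigma}{16L}\sqrt{\frac{d\log d}{n\alpha^2}},\qquad L=\frac{\exp(2c_+)-1}{2}.$$ Then, in the coordinate global case, exact recovery for $(\Theta_d^+(s_d,a_d))_{d\ge1}$ is impossible for all $a=a_d\le a^*_d$ ($a_d>0$), and is possible for all $a=a_d\gg a^*_d$.
   Context: Notation: $a_d\gg b_d$ means $a_d/b_d\to\infty$ as $d\to\infty$. Model: $\sigma>0$, $\theta\in\mathbb{R}^d$; $X^1,\dots,X^n$ are i.i.d. random vectors in $\mathbb{R}^d$ with law $P_\theta$, $X^i=\theta+\sigma\xi^i$, where $\xi^i$ has i.i.d. coordinates whose common law on $\mathbb{R}$ (not depending on $d$) is symmetric around $0$, has variance $1$ and is $c$-strongly log-concave for a constant $c>0$: it has density $p(x)=\exp(-\phi_0(x))\exp(-cx^2/2)$ with $\phi_0:\mathbb{R}\to\mathbb{R}$ a finite even convex function. Moreover the potential $\phi=-\log p$ has curvature bounded from above by a constant $c_+>0$: $\phi(tx+(1-t)y)-[t\phi(x)+(1-t)\phi(y)]\ge-\frac{c_+}2t(1-t)(x-y)^2$ for all $x,y\in\mathbb{R}$, $t\in(0,1)$. $\Theta_d^+(s,a)$ is the set of $\theta\in\mathbb{R}^d$ for which there is $S\subseteq\{1,\dots,d\}$ with at most $s$ elements such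 that $\theta_j\ge a$ for $j\in S$ and $\theta_j=0$ for $j\notin S$. Put $\eta=(I(\theta_j\ne0))_{j=1,\dots,d}$ and $|\hat\eta-\eta|=\sum_{j=1}^d I(\hat\eta_j\neq\eta_j)$. $\mathcal{Q}_\alpha$ is the set of all non-interactive $\alpha$-locally differentially private mechanisms: sequences $Q=(Q^1,\dots,Q^n)$ of Markov kernels from $\mathbb{R}^d$ to $\mathbb{R}^d$ with $Q^i(A\mid x)\le e^\alpha Q^i(A\mid x')$ for all $i$, all measurable $A$, all $x,x'\in\mathbb{R}^d$; given the $X^i$, the $Z^i\sim Q^i(\cdot\mid X^i)$ are drawn independently, and $Q(P_\theta^{\otimes n})$ denotes the law of $(Z^1,\dots,Z^n)$. A selector is a measurable $\hat\eta=\hat\eta(Z^1,\dots,Z^n)\in\{0,1\}^d$; $\mathcal{T}$ is the set of separable selectors, i.e. those for which each $\hat\eta_j$ depends only on $(Z^i_j)_{i=1,\dots,n}$. Exact recovery is possible for $(\Theta_d^+(s_d,a_d))_{d\ge1}$ in the coordinate global case if there exist (for each $d$) $Q\in\mathcal{Q}_\alpha$ and a selector $\hat\eta$ with $\lim_{d\to\infty}\sup_{\theta\in\Theta_d^+(s_d,a_d)}\mathbb{E}_{Q(P_\theta^{\otimes n})}|\hat\eta-\eta|=0$. It is impossible if $\liminf_{d\to\infty}\inf_{Q\in\mathcal{Q}_\alpha}\inf_{\hat\eta\in\mathcal{T}}\sup_{\theta\in\Theta_d^+(s_d,a_d)}\mathbb{E}_{Q(P_\theta^{\otimes n})}|\hat\eta-\eta|>0$.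 *)

theory Defs
  imports "HOL-Probability.Probability"
begin

text \<open>\<open>a\<^sub>d \<ggreater> b\<^sub>d\<close>; as written this forces \<open>a\<^sub>d / b\<^sub>d > 0\<close> for large \<open>d\<close>.\<close>

definition dominates :: "(nat \<Rightarrow> real) \<Rightarrow> (nat \<Rightarrow> real) \<Rightarrow> bool" where
  "dominates a b \<longleftrightarrow> filterlim (\<lambda>d. a d / b d) at_top sequentially"

definition even_strongly_log_concave :: "real \<Rightarrow> (real \<Rightarrow> real) \<Rightarrow> bool" where
  "even_strongly_log_concave c p \<longleftrightarrow>
     (\<exists>\<phi>\<^sub>0. convex_on UNIV \<phi>\<^sub>0 \<and> (\<forall>x. \<phi>\<^sub>0 (- x) = \<phi>\<^sub>0 x) \<and>
        (\<forall>x. p x = exp (- \<phi>\<^sub>0 x) * exp (- c * x\<^sup>2 / 2)))"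

definition curvature_le :: "real \<Rightarrow> (real \<Rightarrow> real) \<Rightarrow> bool" where
  "curvature_le c \<phi> \<longleftrightarrow>
     (\<forall>x y. \<forall>t\<in>{0<..<1}.
        \<phi> (t * x + (1 - t) * y) - (t * \<phi> x + (1 - t) * \<phi> y) \<ge> - (c / 2) * t * (1 - t) * (x - y)\<^sup>2)"

text \<open>Vectors in \<open>\<real>\<^sup>d\<close> are functions on \<open>{..<d}\<close>, extended by \<open>undefined\<close>, so that the
  dimension may vary inside a statement; samples of size \<open>n\<close> are indexed by \<open>{..<n}\<close> likewise.\<close>

abbreviation RV :: "nat \<Rightarrow> (nat \<Rightarrow> real) measure" where
  "RV d \<equiv> (\<Pi>\<^sub>M j\<in>{..<d}. (borel :: real measure))"

abbreviation RVs :: "nat \<Rightarrow> nat \<Rightarrow> (nat \<Rightarrow> nat \<Rightarrow> real) measure" where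
  "RVs n d \<equiv> (\<Pi>\<^sub>M i\<in>{..<n}. RV d)"

text \<open>The law \<open>P\<^sub>\<theta>\<close> of \<open>\<theta> + \<sigma> \<xi>\<close>, where the coordinates of \<open>\<xi>\<close> are i.i.d. with law \<open>\<nu>\<close>.\<close>

definition obs_law :: "real measure \<Rightarrow> real \<Rightarrow> nat \<Rightarrow> (nat \<Rightarrow> real) \<Rightarrow> (nat \<Rightarrow> real) measure" where
  "obs_law \<nu> \<sigma> d \<theta> =
     distr (\<Pi>\<^sub>M j\<in>{..<d}. \<nu>) (RV d) (\<lambda>\<xi>. \<lambda>j\<in>{..<d}. \<theta> j + \<sigma> * \<xi> j)"

definition Theta_plus :: "nat \<Rightarrow> nat \<Rightarrow> real \<Rightarrow> (nat \<Rightarrow> real) set" where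
  "Theta_plus d s a =
     {\<theta> \<in> {..<d} \<rightarrow>\<^sub>E UNIV. \<exists>S\<subseteq>{..<d}. card S \<le> s \<and>
        (\<forall>j\<in>S. a \<le> \<theta> j) \<and> (\<forall>j\<in>{..<d} - S. \<theta> j = 0)}"

definition support_vec :: "nat \<Rightarrow> (nat \<Rightarrow> real) \<Rightarrow> (nat \<Rightarrow> nat)" where
  "support_vec d \<theta> = (\<lambda>j\<in>{..<d}. of_bool (\<theta> j \<noteq> 0))"

definition hamming :: "nat \<Rightarrow> (nat \<Rightarrow> nat) \<Rightarrow> (nat \<Rightarrow> nat) \<Rightarrow> nat" where
  "hamming d \<eta> \<eta>' = (\<Sum>j<d. of_bool (\<eta> j \<noteq> \<eta>' j))"

text \<open>Non-interactive \<open>\<alpha>\<close>-locally differentially private mechanisms; the values \<open>Q i\<close>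
  for \<open>i \<ge> n\<close> are irrelevant.\<close>

definition ldp_mechanisms ::
  "nat \<Rightarrow> nat \<Rightarrow> real \<Rightarrow> (nat \<Rightarrow> (nat \<Rightarrow> real) \<Rightarrow> (nat \<Rightarrow> real) measure) set" where
  "ldp_mechanisms d n \<alpha> =
     {Q. \<forall>i<n. Q i \<in> RV d \<rightarrow>\<^sub>M prob_algebra (RV d) \<and>
        (\<forall>A\<in>sets (RV d). \<forall>x\<in>space (RV d). \<forall>x'\<in>space (RV d).
           measure (Q i x) A \<le> exp \<alpha> * measure (Q i x') A)}"

definition private_law ::
  "nat \<Rightarrow> (nat \<Rightarrow> (nat \<Rightarrow> real) \<Rightarrow> (nat \<Rightarrow> real) measure) \<Rightarrow> (nat \<Rightarrow> real) measure \<Rightarrow>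
    (nat \<Rightarrow> nat \<Rightarrow> real) measure" where
  "private_law n Q P = (\<Pi>\<^sub>M i\<in>{..<n}. P) \<bind> (\<lambda>x. \<Pi>\<^sub>M i\<in>{..<n}. Q i (x i))"

definition selectors :: "nat \<Rightarrow> nat \<Rightarrow> ((nat \<Rightarrow> nat \<Rightarrow> real) \<Rightarrow> (nat \<Rightarrow> nat)) set" where
  "selectors d n = (RVs n d \<rightarrow>\<^sub>M (\<Pi>\<^sub>M j\<in>{..<d}. count_space {0, 1}))"

text \<open>For a measurable selector, dependence on \<open>(z i j)\<^sub>i\<close> alone automatically makes the \<open>j\<close>-th
  component a measurable function of these variables (fix the other variables at \<open>0\<close>).\<close>

definition separable_selectors :: "nat \<Rightarrow> nat \<Rightarrow> ((nat \<Rightarrow> nat \<Rightarrow> real) \<Rightarrow> (nat \<Rightarrow> nat)) set" where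
  "separable_selectors d n =
     {h \<in> selectors d n. \<forall>j<d. \<forall>z\<in>space (RVs n d). \<forall>z'\<in>space (RVs n d).
        (\<forall>i<n. z i j = z' i j) \<longrightarrow> h z j = h z' j}"

text \<open>\<open>\<bbbE> |h - \<eta>|\<close> under \<open>Q(P\<^sub>\<theta>\<^bsup>\<otimes>n\<^esup>)\<close>. It is taken in \<open>ennreal\<close>, a complete lattice, so that the suprema
  and infima below are the genuine ones.\<close>

definition risk ::
  "real measure \<Rightarrow> real \<Rightarrow> nat \<Rightarrow> nat \<Rightarrow> (nat \<Rightarrow> (nat \<Rightarrow> real) \<Rightarrow> (nat \<Rightarrow> real) measure) \<Rightarrow>
    ((nat \<Rightarrow> nat \<Rightarrow> real) \<Rightarrow> (nat \<Rightarrow> nat)) \<Rightarrow> (nat \<Rightarrow> real) \<Rightarrow> ennreal" where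
  "risk \<nu> \<sigma> d n Q h \<theta> =
     (\<integral>\<^sup>+ z. of_nat (hamming d (h z) (support_vec d \<theta>)) \<partial>private_law n Q (obs_law \<nu> \<sigma> d \<theta>))"

definition exact_recovery_possible ::
  "real measure \<Rightarrow> real \<Rightarrow> (nat \<Rightarrow> nat) \<Rightarrow> (nat \<Rightarrow> nat) \<Rightarrow> (nat \<Rightarrow> real) \<Rightarrow> (nat \<Rightarrow> real) \<Rightarrow> bool" where
  "exact_recovery_possible \<nu> \<sigma> n s \<alpha> a \<longleftrightarrow>
     (\<exists>Q h. (\<forall>d\<ge>1. Q d \<in> ldp_mechanisms d (n d) (\<alpha> d) \<and> h d \<in> selectors d (n d)) \<and>
        (\<lambda>d. SUP \<theta>\<in>Theta_plus d (s d) (a d). risk \<nu> \<sigma> d (n d) (Q d) (h d) \<theta>) \<longlonglongrightarrow> 0)"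

definition exact_recovery_impossible ::
  "real measure \<Rightarrow> real \<Rightarrow> (nat \<Rightarrow> nat) \<Rightarrow> (nat \<Rightarrow> nat) \<Rightarrow> (nat \<Rightarrow> real) \<Rightarrow> (nat \<Rightarrow> real) \<Rightarrow> bool" where
  "exact_recovery_impossible \<nu> \<sigma> n s \<alpha> a \<longleftrightarrow>
     liminf (\<lambda>d. INF Q\<in>ldp_mechanisms d (n d) (\<alpha> d). INF h\<in>separable_selectors d (n d).
        SUP \<theta>\<in>Theta_plus d (s d) (a d). risk \<nu> \<sigma> d (n d) Q h \<theta>) > 0"

definition L_const :: "real \<Rightarrow> real" where
  "L_const c_plus = (exp (2 * c_plus) - 1) / 2"

definition a_star :: "real \<Rightarrow> real \<Rightarrow> (nat \<Rightarrow> nat) \<Rightarrow> (nat \<Rightarrow> real) \<Rightarrow> nat \<Rightarrow> real" where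
  "a_star \<sigma> c_plus n \<alpha> d =
     \<sigma> / (16 * L_const c_plus) * sqrt (real d * ln (real d) / (real (n d) * (\<alpha> d)\<^sup>2))"

end

(* Lower bound. Compare theta = 0 with the d spikes a e_j. The likelihood ratio of the j-th spike
   depends on coordinate j alone, so the d scores are orthogonal and centred. Through an alpha-private
   channel, whose conditional laws differ by factors at most exp alpha, a Bessel-type inequality bounds
   the sum over j of the chi-square divergences of the outputs of one user by
   sinh(alpha)^2 (exp(c_plus a^2 / sigma^2) - 1); it is the sum over j, and not each term, that is of
   order alpha^2. Second moments tensorize over the n users. If all risks were below 1/4, Cauchy-Schwarz
   would give each coordinate a false-alarm probability of at least 9/16 exp(-B_j) under theta = 0,
   where the sum of the B_j is at most d ln d, and convexity of exp makes these sum up to at least 9/16.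

   Upper bound. User i reports by randomized response the sign of coordinate i mod d only; each
   coordinate is decided by thresholding its about n/d votes, with a Chernoff bound. *)

theory Submission
  imports Defs
begin

text \<open>Data processing for each spike separately would allow every one of the d divergences to
  be of order \<alpha>^2, and impossibility would follow only for signals smaller by a factor of
  order sqrt d. The joint bound is a duality argument: a divergence at the output is a supremum over
  test functions, so no densities of the output laws are required and every spike may use its own
  test function. The inequality itself comes from two independent inputs \<open>x\<close> and
  \<open>x'\<close>. The channel at \<open>x\<close> is compared with the channel at
  \<open>x'\<close>; with \<open>x'\<close> frozen, the scores at \<open>x\<close> are centred,
  which removes the cosh term, and orthogonal, which leaves only squares in the sinh term. The
  definition of L does not by itself keep c_plus / L^2 bounded for small c_plus; unit variance of
  the noise forces c_plus \<ge> 1/2 and closes this gap. In the upper bound the bias of a vote is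
  linear in the signal only up to signals of order \<sigma>, and then saturates at order \<alpha>.
  In the saturated regime the growth of n \<alpha>^2 / d beyond log d is what makes the votes
  sufficient.\<close>

section \<open>Second-moment comparison of product measures\<close>

lemma integral_unit_interval_bounds:
  fixes f :: "'a \<Rightarrow> real"
  assumes "prob_space M" and "\<And>x. 0 \<le> f x \<and> f x \<le> 1"
  shows "0 \<le> (\<integral>x. f x \<partial>M) \<and> (\<integral>x. f x \<partial>M) \<le> 1"
proof -
  interpret prob_space M by fact
  show ?thesis
  proof (cases "integrable M f")
    case True
    then have "(\<integral>x. f x \<partial>M) \<le> (\<integral>x. 1 \<partial>M)"
      using assms by (intro integral_mono) auto
    then show ?thesis using assms by (auto intro!: Bochner_Integration.integral_nonneg simp: prob_space)
  qed (simp add: not_integrable_integral_eq)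
qed

lemma integrable_unit_interval:
  fixes f :: "'a \<Rightarrow> real"
  assumes "prob_space M" and "f \<in> borel_measurable M" and "\<And>x. 0 \<le> f x \<and> f x \<le> 1"
  shows "integrable M f"
proof -
  interpret prob_space M by fact
  show ?thesis using assms by (intro integrable_const_bound[where B=1]) auto
qed

text \<open>Induction on the number of factors: integrate out one coordinate, apply
  \<open>bound\<close> to the sections of \<open>F\<close>, and hand the square root of the
  resulting second moment to the induction hypothesis. Working with test functions in place of
  densities, the argument asks for no absolute continuity.\<close>

lemma PiM_second_moment_bound:
  fixes M M' :: "'i \<Rightarrow> 'a measure" and C :: "'i \<Rightarrow> real" and F :: "('i \<Rightarrow> 'a) \<Rightarrow> real"
  assumes prob: "\<And>i. prob_space (M i)" "\<And>i. prob_space (M' i)"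
    and sets: "\<And>i. sets (M' i) = sets (M i)"
    and "finite I"
    and C: "\<And>i. i \<in> I \<Longrightarrow> 0 \<le> C i"
    and bound: "\<And>i G. i \<in> I \<Longrightarrow> G \<in> borel_measurable (M i) \<Longrightarrow> (\<And>x. 0 \<le> G x \<and> G x \<le> 1) \<Longrightarrow>
      (\<integral>x. G x \<partial>M' i)\<^sup>2 \<le> C i * (\<integral>x. (G x)\<^sup>2 \<partial>M i)"
    and "F \<in> borel_measurable (PiM I M)" and "\<And>x. 0 \<le> F x \<and> F x \<le> 1"
  shows "(\<integral>x. F x \<partial>PiM I M')\<^sup>2 \<le> (\<Prod>i\<in>I. C i) * (\<integral>x. (F x)\<^sup>2 \<partial>PiM I M)"
proof -
  interpret pm: product_prob_space M UNIV
    using prob(1) by (rule product_prob_spaceI)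
  interpret pm': product_prob_space M' UNIV
    using prob(2) by (rule product_prob_spaceI)
  show ?thesis
    using assms(4-8)
  proof (induction I arbitrary: F rule: finite_induct)
    case empty
    show ?case by (simp add: PiM_empty lebesgue_integral_count_space_finite)
  next
    case (insert i I)
    have pP: "prob_space (PiM J M)" "prob_space (PiM J M')" for J
      by (auto intro!: prob_space_PiM prob)
    have setsP: "sets (PiM J M') = sets (PiM J M)" for J
      by (intro sets_PiM_cong) (auto simp: sets)
    have meas': "f \<in> borel_measurable (PiM J M')" if "f \<in> borel_measurable (PiM J M)" for f :: "_ \<Rightarrow> real" and J
      using that measurable_cong_sets[OF setsP refl] by blast
    note F = insert.prems(3) and F01 = insert.prems(4)
    define G H where "G x = (\<integral>y. F (x(i := y)) \<partial>M' i)" and "H x = (\<integral>y. (F (x(i := y)))\<^sup>2 \<partial>M i)" for x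
    have F2: "0 \<le> (F x)\<^sup>2 \<and> (F x)\<^sup>2 \<le> 1" for x
      using F01 by (simp add: power_le_one)
    have G01: "0 \<le> G x \<and> G x \<le> 1" and H01: "0 \<le> H x \<and> H x \<le> 1" for x
      unfolding G_def H_def
      using integral_unit_interval_bounds[OF prob(2)] F01 integral_unit_interval_bounds[OF prob(1)] F2 by auto
    have upd: "(\<lambda>(x, y). x(i := y)) \<in> PiM I M \<Otimes>\<^sub>M M i \<rightarrow>\<^sub>M PiM (insert i I) M"
      "(\<lambda>(x, y). x(i := y)) \<in> PiM I M' \<Otimes>\<^sub>M M' i \<rightarrow>\<^sub>M PiM (insert i I) M'"
      by (rule measurable_add_dim)+
    have Gm: "G \<in> borel_measurable (PiM I M')"
    proof -
      have "(\<lambda>p. F ((fst p)(i := snd p))) \<in> borel_measurable (PiM I M' \<Otimes>\<^sub>M M' i)"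
        using measurable_compose[OF upd(2) meas'[OF F]] by (simp add: split_def fun_upd_def)
      then show ?thesis
        unfolding G_def by (intro sigma_finite_measure.borel_measurable_lebesgue_integral[OF prob_space_imp_sigma_finite[OF prob(2)]]) (simp add: split_def fun_upd_def)
    qed
    have Hm: "H \<in> borel_measurable (PiM I M)"
    proof -
      have "(\<lambda>p. (F ((fst p)(i := snd p)))\<^sup>2) \<in> borel_measurable (PiM I M \<Otimes>\<^sub>M M i)"
        using measurable_compose[OF upd(1) F] by (simp add: split_def fun_upd_def)
      then show ?thesis
        unfolding H_def by (intro sigma_finite_measure.borel_measurable_lebesgue_integral[OF prob_space_imp_sigma_finite[OF prob(1)]]) (simp add: split_def fun_upd_def)
    qed
    \<comment> \<open>\<open>sqrt H\<close> is again [0,1]-valued, and its square is the section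
      integral of the square of \<open>F\<close>, so the second moments chain up without
      loss.\<close>
    have sqH: "(\<lambda>x. sqrt (H x)) \<in> borel_measurable (PiM I M)" "0 \<le> sqrt (H x) \<and> sqrt (H x) \<le> 1" for x
      using Hm H01 by auto
    have Ci: "0 \<le> C i" using insert.prems(1) by simp
    have GH: "G x \<le> sqrt (C i) * sqrt (H x)" if "x \<in> space (PiM I M')" for x
    proof -
      have x: "x \<in> space (PiM I M)" using that setsP sets_eq_imp_space_eq by metis
      have "(\<lambda>y. x(i := y)) \<in> M i \<rightarrow>\<^sub>M PiM (insert i I) M"
        using x by (rule measurable_component_update) fact
      then have "(\<lambda>y. F (x(i := y))) \<in> borel_measurable (M i)"
        using F by (rule measurable_compose)
      then have "(G x)\<^sup>2 \<le> C i * H x"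
        unfolding G_def H_def by (intro insert.prems(2)) (use F01 in auto)
      then show ?thesis
        using G01 by (simp add: real_le_rsqrt flip: real_sqrt_mult)
    qed
    have "(\<integral>x. F x \<partial>PiM (insert i I) M') = (\<integral>x. G x \<partial>PiM I M')"
      unfolding G_def using insert.hyps
      by (intro pm'.product_integral_insert integrable_unit_interval pP meas' F F01)
    also have "\<dots> \<le> (\<integral>x. sqrt (C i) * sqrt (H x) \<partial>PiM I M')"
      using GH by (intro integral_mono integrable_mult_right integrable_unit_interval pP Gm meas' sqH(1) G01)
        (use sqH in auto)
    also have "\<dots> = sqrt (C i) * (\<integral>x. sqrt (H x) \<partial>PiM I M')"
      by simp
    finally have "(\<integral>x. F x \<partial>PiM (insert i I) M') \<le> sqrt (C i) * (\<integral>x. sqrt (H x) \<partial>PiM I M')" .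
    then have "(\<integral>x. F x \<partial>PiM (insert i I) M')\<^sup>2 \<le> (sqrt (C i) * (\<integral>x. sqrt (H x) \<partial>PiM I M'))\<^sup>2"
      using integral_unit_interval_bounds[OF pP(2) F01] by (intro power_mono) auto
    also have "\<dots> = C i * (\<integral>x. sqrt (H x) \<partial>PiM I M')\<^sup>2"
      using Ci by (simp add: power_mult_distrib)
    also have "\<dots> \<le> C i * ((\<Prod>i\<in>I. C i) * (\<integral>x. (sqrt (H x))\<^sup>2 \<partial>PiM I M))"
      using Ci insert.prems(1,2) sqH by (intro mult_left_mono insert.IH) auto
    also have "\<dots> = (\<Prod>i\<in>insert i I. C i) * (\<integral>x. H x \<partial>PiM I M)"
      using insert.hyps H01 by simp
    also have "(\<integral>x. H x \<partial>PiM I M) = (\<integral>x. (F x)\<^sup>2 \<partial>PiM (insert i I) M)"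
      unfolding H_def using insert.hyps F F2
      by (intro pm.product_integral_insert[symmetric] integrable_unit_interval pP) auto
    finally show ?case .
  qed
qed

section \<open>Private channels and their action on bounded functions\<close>

text \<open>The bound is demanded at every point and refers to no measure, so one class of test
  functions serves all the laws \<open>K x\<close> at once.\<close>

definition bounded_measurable :: "'b measure \<Rightarrow> ('b \<Rightarrow> real) \<Rightarrow> bool" where
  "bounded_measurable Z F \<longleftrightarrow> F \<in> borel_measurable Z \<and> (\<exists>B. \<forall>z. \<bar>F z\<bar> \<le> B)"

lemma
  shows bounded_measurable_const: "bounded_measurable Z (\<lambda>z. r)"
    and bounded_measurable_add: "bounded_measurable Z F \<Longrightarrow> bounded_measurable Z G \<Longrightarrow> bounded_measurable Z (\<lambda>z. F z + G z)"
    and bounded_measurable_mult: "bounded_measurable Z F \<Longrightarrow> bounded_measurable Z G \<Longrightarrow> bounded_measurable Z (\<lambda>z. F z * G z)"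
    and bounded_measurable_abs: "bounded_measurable Z F \<Longrightarrow> bounded_measurable Z (\<lambda>z. \<bar>F z\<bar>)"
proof -
  show "bounded_measurable Z (\<lambda>z. r)"
    by (auto simp: bounded_measurable_def)
  assume F: "bounded_measurable Z F"
  then show "bounded_measurable Z (\<lambda>z. \<bar>F z\<bar>)"
    by (auto simp: bounded_measurable_def)
  assume G: "bounded_measurable Z G"
  obtain B C where B: "\<bar>F z\<bar> \<le> B" and C: "\<bar>G z\<bar> \<le> C" for z
    using F G by (auto simp: bounded_measurable_def)
  have "0 \<le> B" using B[of undefined] by simp
  then have "\<bar>F z + G z\<bar> \<le> B + C" "\<bar>F z * G z\<bar> \<le> B * C" for z
    using B[of z] C[of z] by (auto simp: abs_mult intro!: mult_mono)
  then show "bounded_measurable Z (\<lambda>z. F z + G z)" "bounded_measurable Z (\<lambda>z. F z * G z)"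
    using F G unfolding bounded_measurable_def by (auto intro!: exI)
qed

lemma bounded_measurable_sum:
  "finite J \<Longrightarrow> (\<And>j. j \<in> J \<Longrightarrow> bounded_measurable Z (F j)) \<Longrightarrow> bounded_measurable Z (\<lambda>z. \<Sum>j\<in>J. F j z)"
  by (induction J rule: finite_induct) (auto intro!: bounded_measurable_const bounded_measurable_add)

lemma integrable_bounded_measurable:
  assumes "prob_space M" "sets M = sets Z" "bounded_measurable Z F"
  shows "integrable M F"
proof -
  interpret prob_space M by fact
  obtain B where "F \<in> borel_measurable Z" "\<And>z. \<bar>F z\<bar> \<le> B"
    using assms(3) by (auto simp: bounded_measurable_def)
  then show ?thesis
    using measurable_cong_sets[OF assms(2) refl] by (intro integrable_const_bound[where B=B]) auto
qed

lemma integrable_mult_square_integrable: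
  fixes f g :: "'a \<Rightarrow> real"
  assumes "f \<in> borel_measurable M" "g \<in> borel_measurable M"
    and "integrable M (\<lambda>x. (f x)\<^sup>2)" "integrable M (\<lambda>x. (g x)\<^sup>2)"
  shows "integrable M (\<lambda>x. f x * g x)"
proof (rule Bochner_Integration.integrable_bound)
  show "integrable M (\<lambda>x. (f x)\<^sup>2 + (g x)\<^sup>2)" using assms by auto
  have "\<bar>f x * g x\<bar> \<le> (f x)\<^sup>2 + (g x)\<^sup>2" for x
  proof -
    have "2 * (\<bar>f x\<bar> * \<bar>g x\<bar>) \<le> (f x)\<^sup>2 + (g x)\<^sup>2"
      using sum_squares_bound[of "\<bar>f x\<bar>" "\<bar>g x\<bar>"] by simp
    moreover have "0 \<le> \<bar>f x\<bar> * \<bar>g x\<bar>" by simp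
    ultimately show ?thesis unfolding abs_mult by linarith
  qed
  then show "AE x in M. norm (f x * g x) \<le> norm ((f x)\<^sup>2 + (g x)\<^sup>2)"
    by (intro AE_I2) (simp add: abs_le_iff)
qed (use assms in auto)

locale ldp_channel = prob_space N for N :: "'a measure" +
  fixes K :: "'a \<Rightarrow> 'b measure" and Z :: "'b measure" and \<alpha> :: real
  assumes kernel: "K \<in> N \<rightarrow>\<^sub>M prob_algebra Z"
    and ratio: "\<And>A x x'. A \<in> sets Z \<Longrightarrow> x \<in> space N \<Longrightarrow> x' \<in> space N \<Longrightarrow>
      measure (K x) A \<le> exp \<alpha> * measure (K x') A"
begin

text \<open>The Markov operator of the channel: the conditional expectation of \<open>F\<close> at
  the output, given the input.\<close>

definition T :: "('b \<Rightarrow> real) \<Rightarrow> 'a \<Rightarrow> real" where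
  "T F x = (\<integral>z. F z \<partial>K x)"

lemma prob_space_K: "x \<in> space N \<Longrightarrow> prob_space (K x)" and sets_K: "x \<in> space N \<Longrightarrow> sets (K x) = sets Z"
  using measurable_space[OF kernel] by (auto simp: space_prob_algebra)

lemma integrable_K: "x \<in> space N \<Longrightarrow> bounded_measurable Z F \<Longrightarrow> integrable (K x) F"
  using integrable_bounded_measurable prob_space_K sets_K by blast

lemma abs_T_le:
  assumes "x \<in> space N" "bounded_measurable Z F" "\<And>z. \<bar>F z\<bar> \<le> B"
  shows "\<bar>T F x\<bar> \<le> B"
proof -
  interpret K: prob_space "K x" using assms by (intro prob_space_K)
  have "\<bar>T F x\<bar> \<le> (\<integral>z. \<bar>F z\<bar> \<partial>K x)"
    unfolding T_def by (rule integral_abs_bound)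
  also have "\<dots> \<le> (\<integral>z. B \<partial>K x)"
    using assms by (intro integral_mono integrable_K) (auto intro!: bounded_measurable_abs bounded_measurable_const)
  finally show ?thesis by (simp add: K.prob_space)
qed

lemma T_measurable: "bounded_measurable Z F \<Longrightarrow> T F \<in> borel_measurable N"
  unfolding T_def bounded_measurable_def
  by (auto intro!: measurable_compose[OF measurable_prob_algebraD[OF kernel]])

lemma T_bounded:
  assumes "bounded_measurable Z F"
  obtains B where "0 \<le> B" "\<And>x. x \<in> space N \<Longrightarrow> \<bar>T F x\<bar> \<le> B"
proof -
  obtain B where "\<And>z. \<bar>F z\<bar> \<le> B" using assms by (auto simp: bounded_measurable_def)
  moreover from this[of undefined] have "0 \<le> B" by simp
  ultimately show ?thesis using that abs_T_le[OF _ assms] by blast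
qed

lemma integrable_T:
  assumes "bounded_measurable Z F"
  shows "integrable N (T F)"
proof -
  obtain B where "\<And>x. x \<in> space N \<Longrightarrow> \<bar>T F x\<bar> \<le> B" using T_bounded[OF assms] by metis
  then show ?thesis
    using T_measurable[OF assms] by (intro integrable_const_bound[where B=B]) (auto intro!: AE_I2)
qed

lemma integrable_mult_T:
  assumes "integrable N g" "bounded_measurable Z F"
  shows "integrable N (\<lambda>x. g x * T F x)"
proof -
  obtain B where B: "0 \<le> B" "\<And>x. x \<in> space N \<Longrightarrow> \<bar>T F x\<bar> \<le> B" using T_bounded[OF assms(2)] by metis
  have "integrable N (\<lambda>x. g x * B)" using assms by auto
  then show ?thesis
    using T_measurable[OF assms(2)] borel_measurable_integrable[OF assms(1)] B
    by (elim Bochner_Integration.integrable_bound)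
       (auto intro!: AE_I2 mult_left_mono simp: abs_mult)
qed

text \<open>The privacy ratio for events is an inequality between the measures \<open>K x\<close>
  and \<open>exp \<alpha>\<close> times \<open>K x'\<close>; integrals of nonnegative functions
  inherit it.\<close>

lemma T_le:
  assumes F: "bounded_measurable Z F" "\<And>z. 0 \<le> F z" and x: "x \<in> space N" "x' \<in> space N"
  shows "T F x \<le> exp \<alpha> * T F x'"
proof -
  interpret K: prob_space "K x" using x by (intro prob_space_K)
  interpret K': prob_space "K x'" using x by (intro prob_space_K)
  have Fm: "F \<in> borel_measurable (K x)" "F \<in> borel_measurable (K x')"
    using borel_measurable_integrable integrable_K F x by blast+
  have "emeasure (K x) A \<le> emeasure (scale_measure (ennreal (exp \<alpha>)) (K x')) A" if "A \<in> sets (K x)" for A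
    using ratio[of A x x'] that x sets_K
    by (simp add: K.emeasure_eq_measure K'.emeasure_eq_measure flip: ennreal_mult)
  then have "K x \<le> scale_measure (ennreal (exp \<alpha>)) (K x')"
    using sets_K x by (subst le_measure) auto
  then have "(\<integral>\<^sup>+z. ennreal (F z) \<partial>K x) \<le> (\<integral>\<^sup>+z. ennreal (F z) \<partial>scale_measure (ennreal (exp \<alpha>)) (K x'))"
    using sets_K x by (intro nn_integral_mono_measure) auto
  also have "\<dots> = ennreal (exp \<alpha>) * (\<integral>\<^sup>+z. ennreal (F z) \<partial>K x')"
    using Fm by (subst nn_integral_scale_measure) auto
  finally have "ennreal (T F x) \<le> ennreal (exp \<alpha> * T F x')"
    unfolding T_def using F integrable_K x
    by (simp add: nn_integral_eq_integral ennreal_mult)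
  moreover have "0 \<le> exp \<alpha> * T F x'" unfolding T_def using F by auto
  ultimately show ?thesis by simp
qed

lemma T_add: "bounded_measurable Z F \<Longrightarrow> bounded_measurable Z G \<Longrightarrow> x \<in> space N \<Longrightarrow>
    T (\<lambda>z. F z + G z) x = T F x + T G x"
  unfolding T_def by (intro Bochner_Integration.integral_add integrable_K)

lemma T_cmult: "T (\<lambda>z. r * F z) x = r * T F x"
  unfolding T_def by simp

lemma T_sum: "(\<And>j. j \<in> J \<Longrightarrow> bounded_measurable Z (F j)) \<Longrightarrow> x \<in> space N \<Longrightarrow>
    T (\<lambda>z. \<Sum>j\<in>J. F j z) x = (\<Sum>j\<in>J. T (F j) x)"
  unfolding T_def by (intro Bochner_Integration.integral_sum integrable_K)

text \<open>Split \<open>F\<close> into positive and negative part, and note that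
  \<open>e\<^bsup>\<alpha>\<^esup> F\<^sup>+ - e\<^bsup>-\<alpha>\<^esup> F\<^sup>- = cosh \<alpha> F + sinh \<alpha> |F|\<close>.\<close>

lemma T_le_cosh_sinh:
  assumes F: "bounded_measurable Z F" and x: "x \<in> space N" "x' \<in> space N"
  shows "T F x \<le> cosh \<alpha> * T F x' + sinh \<alpha> * T (\<lambda>z. \<bar>F z\<bar>) x'"
proof -
  define P M where "P z = (\<bar>F z\<bar> + F z) / 2" and "M z = (\<bar>F z\<bar> + (-1) * F z) / 2" for z
  note intros = bounded_measurable_const bounded_measurable_add bounded_measurable_mult bounded_measurable_abs F
  have bP: "bounded_measurable Z P" and bM: "bounded_measurable Z M"
    unfolding P_def M_def divide_inverse by (intro intros)+
  have P0: "0 \<le> P z" and M0: "0 \<le> M z" for z by (auto simp: P_def M_def)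
  have TF: "T F y = T P y - T M y" if "y \<in> space N" for y
  proof -
    have "T F y = (\<integral>z. P z - M z \<partial>K y)" by (simp add: T_def P_def M_def field_simps)
    then show ?thesis
      using that by (simp add: T_def integrable_K bP bM)
  qed
  have Tabs: "T (\<lambda>z. \<bar>F z\<bar>) x' = T P x' + T M x'"
  proof -
    have "T (\<lambda>z. \<bar>F z\<bar>) x' = T (\<lambda>z. P z + M z) x'" by (simp add: P_def M_def field_simps)
    then show ?thesis using x bP bM by (simp add: T_add)
  qed
  have "T P x \<le> exp \<alpha> * T P x'" by (rule T_le[OF bP P0 x])
  moreover have "T M x' \<le> exp \<alpha> * T M x" by (rule T_le[OF bM M0 x(2,1)])
  then have "exp (-\<alpha>) * T M x' \<le> T M x"
    by (simp add: exp_minus field_simps)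
  ultimately show ?thesis
    using x by (simp add: TF Tabs cosh_def sinh_def field_simps)
qed

end

section \<open>Bessel inequality for orthogonal perturbations seen through a private channel\<close>

text \<open>Each \<open>1 + g j\<close> is meant to be the likelihood ratio of an alternative input
  law, so that \<kappa> bounds its chi-square divergence before privatization.\<close>

locale ldp_perturbations = ldp_channel N K Z \<alpha>
  for N :: "'a measure" and K :: "'a \<Rightarrow> 'b measure" and Z and \<alpha> +
  fixes J :: "'j set" and g :: "'j \<Rightarrow> 'a \<Rightarrow> real" and \<kappa> :: real
  assumes finite_J: "finite J" and \<kappa>_pos: "0 < \<kappa>"
    and g_measurable: "\<And>j. j \<in> J \<Longrightarrow> g j \<in> borel_measurable N"
    and g_square: "\<And>j. j \<in> J \<Longrightarrow> integrable N (\<lambda>x. (g j x)\<^sup>2)"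
    and g_mean: "\<And>j. j \<in> J \<Longrightarrow> (\<integral>x. g j x \<partial>N) = 0"
    and g_orthogonal: "\<And>j k. j \<in> J \<Longrightarrow> k \<in> J \<Longrightarrow> j \<noteq> k \<Longrightarrow> (\<integral>x. g j x * g k x \<partial>N) = 0"
    and g_norm: "\<And>j. j \<in> J \<Longrightarrow> (\<integral>x. (g j x)\<^sup>2 \<partial>N) \<le> \<kappa>"
begin

lemma g_integrable: "j \<in> J \<Longrightarrow> integrable N (g j)"
  by (rule square_integrable_imp_integrable[OF g_measurable g_square])

lemma g_prod_integrable: "j \<in> J \<Longrightarrow> k \<in> J \<Longrightarrow> integrable N (\<lambda>x. g j x * g k x)"
  by (rule integrable_mult_square_integrable[OF g_measurable g_measurable g_square g_square])

text \<open>The comparison of \<open>K x\<close> with \<open>K x'\<close> is applied to the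
  combination of the \<open>F j\<close> with coefficients \<open>g j x\<close>. On the right
  \<open>x\<close> then occurs only in these coefficients, linearly or quadratically, which is the
  form in which centring and orthogonality can act after integration over \<open>x\<close>.\<close>

lemma scores_le_at:
  assumes F: "\<And>j. j \<in> J \<Longrightarrow> bounded_measurable Z (F j)" and x: "x \<in> space N" "x' \<in> space N"
  shows "(\<Sum>j\<in>J. g j x * T (F j) x) \<le> cosh \<alpha> * (\<Sum>j\<in>J. g j x * T (F j) x') +
    ((sinh \<alpha>)\<^sup>2 * \<kappa> + (\<Sum>j\<in>J. \<Sum>k\<in>J. g j x * g k x * T (\<lambda>z. F j z * F k z) x') / \<kappa>) / 2"
proof -
  define \<Phi> where "\<Phi> z = (\<Sum>j\<in>J. g j x * F j z)" for z
  define s where "s = sinh \<alpha>"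
  note intros = bounded_measurable_sum[OF finite_J] bounded_measurable_const bounded_measurable_add
    bounded_measurable_mult bounded_measurable_abs F
  have b\<Phi>: "bounded_measurable Z \<Phi>"
    unfolding \<Phi>_def by (intro intros)
  have T\<Phi>: "T \<Phi> y = (\<Sum>j\<in>J. g j x * T (F j) y)" if "y \<in> space N" for y
    unfolding \<Phi>_def using that by (subst T_sum) (auto intro!: intros simp: T_cmult)
  have "\<Phi> z * \<Phi> z = (\<Sum>j\<in>J. \<Sum>k\<in>J. (g j x * g k x) * (F j z * F k z))" for z
    unfolding \<Phi>_def sum_product by (simp add: mult_ac)
  then have T2: "T (\<lambda>z. \<Phi> z * \<Phi> z) x' = (\<Sum>j\<in>J. \<Sum>k\<in>J. g j x * g k x * T (\<lambda>z. F j z * F k z) x')"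
    using x by (simp add: T_sum T_cmult intros)
  \<comment> \<open>The absolute value destroys linearity in the \<open>g j x\<close>; the
    inequality between arithmetic and geometric mean replaces it by a square. The weight \<kappa> is
    chosen so that its inverse cancels the later bound \<kappa> on the norms of the
    \<open>g j\<close>.\<close>
  have abs_le: "s * \<bar>\<Phi> z\<bar> \<le> (s\<^sup>2 * \<kappa> + (1 / \<kappa>) * (\<Phi> z * \<Phi> z)) / 2" for z
  proof -
    have "0 \<le> (s * \<kappa> - \<bar>\<Phi> z\<bar>)\<^sup>2" by simp
    then have "2 * (s * \<bar>\<Phi> z\<bar>) * \<kappa> \<le> s\<^sup>2 * \<kappa> * \<kappa> + \<Phi> z * \<Phi> z"
      by (simp add: power2_eq_square algebra_simps abs_mult_self_eq)
    then show ?thesis using \<kappa>_pos by (simp add: field_simps)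
  qed
  have "sinh \<alpha> * T (\<lambda>z. \<bar>\<Phi> z\<bar>) x' = (\<integral>z. s * \<bar>\<Phi> z\<bar> \<partial>K x')"
    by (simp add: T_def s_def)
  also have "\<dots> \<le> (\<integral>z. (1 / 2) * (s\<^sup>2 * \<kappa> + (1 / \<kappa>) * (\<Phi> z * \<Phi> z)) \<partial>K x')"
    by (intro integral_mono integrable_K x intros b\<Phi>) (use abs_le in simp)
  also have "\<dots> = (1 / 2) * T (\<lambda>z. s\<^sup>2 * \<kappa> + (1 / \<kappa>) * (\<Phi> z * \<Phi> z)) x'"
    by (simp add: T_def)
  also have "T (\<lambda>z. s\<^sup>2 * \<kappa> + (1 / \<kappa>) * (\<Phi> z * \<Phi> z)) x' = s\<^sup>2 * \<kappa> + (1 / \<kappa>) * T (\<lambda>z. \<Phi> z * \<Phi> z) x'"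
  proof -
    have "bounded_measurable Z (\<lambda>z. (1 / \<kappa>) * (\<Phi> z * \<Phi> z))" by (intro intros b\<Phi>)
    then show ?thesis
      using x prob_space.prob_space[OF prob_space_K[OF x(2)]]
      by (subst T_add) (auto simp: bounded_measurable_const T_def)
  qed
  finally have "sinh \<alpha> * T (\<lambda>z. \<bar>\<Phi> z\<bar>) x' \<le> (s\<^sup>2 * \<kappa> + T (\<lambda>z. \<Phi> z * \<Phi> z) x' / \<kappa>) / 2"
    by simp
  moreover have "T \<Phi> x \<le> cosh \<alpha> * T \<Phi> x' + sinh \<alpha> * T (\<lambda>z. \<bar>\<Phi> z\<bar>) x'"
    by (rule T_le_cosh_sinh[OF b\<Phi> x])
  ultimately show ?thesis
    unfolding T2 T\<Phi>[OF x(1)] T\<Phi>[OF x(2)] s_def by linarith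
qed

text \<open>Integrate \<open>scores_le_at\<close> first over \<open>x\<close>, where orthogonality (Bessel) removes the
  off-diagonal terms, then over \<open>x'\<close>.\<close>

lemma sum_scores_le:
  assumes F: "\<And>j. j \<in> J \<Longrightarrow> bounded_measurable Z (F j)"
  shows "(\<Sum>j\<in>J. \<integral>x. g j x * T (F j) x \<partial>N) \<le>
    ((sinh \<alpha>)\<^sup>2 * \<kappa> + (\<Sum>j\<in>J. \<integral>x. T (\<lambda>z. F j z * F j z) x \<partial>N)) / 2"
proof -
  define S where "S = (\<Sum>j\<in>J. \<integral>x. g j x * T (F j) x \<partial>N)"
  have bFF: "bounded_measurable Z (\<lambda>z. F j z * F k z)" if "j \<in> J" "k \<in> J" for j k
    using that by (intro bounded_measurable_mult F)
  have *: "S \<le> ((sinh \<alpha>)\<^sup>2 * \<kappa> + (\<Sum>j\<in>J. T (\<lambda>z. F j z * F j z) x')) / 2" if x': "x' \<in> space N" for x'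
  proof -
    define c where "c j k = T (\<lambda>z. F j z * F k z) x'" for j k
    have int: "integrable N (\<lambda>x. \<Sum>j\<in>J. \<Sum>k\<in>J. g j x * g k x * c j k)"
      by (intro Bochner_Integration.integrable_sum integrable_mult_left g_prod_integrable)
    have int2: "integrable N (\<lambda>x. \<Sum>j\<in>J. g j x * T (F j) x')"
      by (intro Bochner_Integration.integrable_sum integrable_mult_left g_integrable)
    have "S = (\<integral>x. (\<Sum>j\<in>J. g j x * T (F j) x) \<partial>N)"
      unfolding S_def by (intro Bochner_Integration.integral_sum[symmetric] integrable_mult_T g_integrable F)
    also have "\<dots> \<le> (\<integral>x. cosh \<alpha> * (\<Sum>j\<in>J. g j x * T (F j) x') +
        ((sinh \<alpha>)\<^sup>2 * \<kappa> + (\<Sum>j\<in>J. \<Sum>k\<in>J. g j x * g k x * c j k) / \<kappa>) / 2 \<partial>N)"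
      unfolding c_def using int[unfolded c_def] int2
      by (intro integral_mono scores_le_at F x' Bochner_Integration.integrable_add integrable_mult_right
          integrable_divide Bochner_Integration.integrable_sum integrable_mult_T g_integrable F)
        (simp_all add: g_integrable g_prod_integrable)
    also have "\<dots> = cosh \<alpha> * (\<integral>x. (\<Sum>j\<in>J. g j x * T (F j) x') \<partial>N) +
        ((sinh \<alpha>)\<^sup>2 * \<kappa> + (\<integral>x. (\<Sum>j\<in>J. \<Sum>k\<in>J. g j x * g k x * c j k) \<partial>N) / \<kappa>) / 2"
      using int int2 by (simp add: prob_space)
    also have "(\<integral>x. (\<Sum>j\<in>J. g j x * T (F j) x') \<partial>N) = 0"
      by (simp add: g_integrable g_mean)
    also have "(\<integral>x. (\<Sum>j\<in>J. \<Sum>k\<in>J. g j x * g k x * c j k) \<partial>N) =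
        (\<Sum>j\<in>J. \<Sum>k\<in>J. (\<integral>x. g j x * g k x \<partial>N) * c j k)"
      by (simp add: g_prod_integrable)
    also have "\<dots> = (\<Sum>j\<in>J. \<Sum>k\<in>J. if k = j then (\<integral>x. g j x * g j x \<partial>N) * c j j else 0)"
      by (intro sum.cong refl) (auto simp: g_orthogonal)
    also have "\<dots> = (\<Sum>j\<in>J. (\<integral>x. g j x * g j x \<partial>N) * c j j)"
      using finite_J by (simp add: sum.delta)
    also have "cosh \<alpha> * 0 + ((sinh \<alpha>)\<^sup>2 * \<kappa> + (\<Sum>j\<in>J. (\<integral>x. g j x * g j x \<partial>N) * c j j) / \<kappa>) / 2
        \<le> ((sinh \<alpha>)\<^sup>2 * \<kappa> + (\<Sum>j\<in>J. \<kappa> * c j j) / \<kappa>) / 2"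
    proof -
      have "0 \<le> c j j" for j unfolding c_def T_def by (intro Bochner_Integration.integral_nonneg) simp
      then have "(\<Sum>j\<in>J. (\<integral>x. g j x * g j x \<partial>N) * c j j) \<le> (\<Sum>j\<in>J. \<kappa> * c j j)"
        using g_norm by (intro sum_mono mult_right_mono) (auto simp: power2_eq_square)
      then show ?thesis using \<kappa>_pos by (simp add: divide_right_mono)
    qed
    also have "(\<Sum>j\<in>J. \<kappa> * c j j) / \<kappa> = (\<Sum>j\<in>J. c j j)"
      using \<kappa>_pos by (simp flip: sum_distrib_left)
    finally show ?thesis unfolding c_def .
  qed
  have "S = (\<integral>x'. S \<partial>N)" by (simp add: prob_space)
  also have "\<dots> \<le> (\<integral>x'. ((sinh \<alpha>)\<^sup>2 * \<kappa> + (\<Sum>j\<in>J. T (\<lambda>z. F j z * F j z) x')) / 2 \<partial>N)"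
    using * by (intro integral_mono Bochner_Integration.integrable_add integrable_divide
        Bochner_Integration.integrable_sum integrable_T bFF) auto
  also have "\<dots> = ((sinh \<alpha>)\<^sup>2 * \<kappa> + (\<Sum>j\<in>J. \<integral>x. T (\<lambda>z. F j z * F j z) x \<partial>N)) / 2"
    by (simp add: integrable_T bFF prob_space)
  finally show ?thesis unfolding S_def .
qed

text \<open>How much the perturbation \<open>1 + g j\<close> of the input law changes the
  expectation of \<open>F\<close> at the output.\<close>

definition score :: "'j \<Rightarrow> ('b \<Rightarrow> real) \<Rightarrow> real" where
  "score j F = (\<integral>x. g j x * T F x \<partial>N)"

definition second_moment :: "('b \<Rightarrow> real) \<Rightarrow> real" where
  "second_moment F = (\<integral>x. T (\<lambda>z. F z * F z) x \<partial>N)"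

lemma score_cmult: "score j (\<lambda>z. r * F z) = r * score j F"
  unfolding score_def T_cmult by (simp add: mult.left_commute)

lemma second_moment_cmult: "second_moment (\<lambda>z. r * F z) = r\<^sup>2 * second_moment F"
proof -
  have "T (\<lambda>z. r * F z * (r * F z)) = (\<lambda>x. r\<^sup>2 * T (\<lambda>z. F z * F z) x)"
    by (rule ext) (simp add: mult_ac power2_eq_square flip: T_cmult)
  then show ?thesis unfolding second_moment_def by simp
qed

lemma second_moment_nonneg: "0 \<le> second_moment F"
  unfolding second_moment_def T_def by (intro Bochner_Integration.integral_nonneg) simp

text \<open>Rescaling each \<open>F j\<close> by its own score makes the linear side of
  \<open>sum_scores_le\<close> a sum of squares. The second moments on the other side are at most
  the same squares, with factor 1/2, and are absorbed.\<close>

lemma sum_score_squares_le: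
  assumes F: "\<And>j. j \<in> J \<Longrightarrow> bounded_measurable Z (F j)" "\<And>j. j \<in> J \<Longrightarrow> second_moment (F j) \<le> 1"
  shows "(\<Sum>j\<in>J. (score j (F j))\<^sup>2) \<le> (sinh \<alpha>)\<^sup>2 * \<kappa>"
proof -
  let ?G = "\<lambda>j z. score j (F j) * F j z"
  have "(\<Sum>j\<in>J. (score j (F j))\<^sup>2) = (\<Sum>j\<in>J. score j (?G j))"
    by (simp add: score_cmult power2_eq_square)
  also have "\<dots> \<le> ((sinh \<alpha>)\<^sup>2 * \<kappa> + (\<Sum>j\<in>J. second_moment (?G j))) / 2"
    unfolding score_def[of _ "?G _"] second_moment_def
    by (rule sum_scores_le) (auto intro!: bounded_measurable_mult bounded_measurable_const F)
  finally have "2 * (\<Sum>j\<in>J. (score j (F j))\<^sup>2) \<le> (sinh \<alpha>)\<^sup>2 * \<kappa> + (\<Sum>j\<in>J. second_moment (?G j))"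
    by simp
  moreover have "(\<Sum>j\<in>J. second_moment (?G j)) \<le> (\<Sum>j\<in>J. (score j (F j))\<^sup>2)"
    unfolding second_moment_cmult by (intro sum_mono mult_left_le F) auto
  ultimately show ?thesis by simp
qed

lemma score_square_le:
  assumes "j \<in> J" "bounded_measurable Z F" "second_moment F \<le> 1"
  shows "(score j F)\<^sup>2 \<le> (sinh \<alpha>)\<^sup>2 * \<kappa>"
proof -
  \<comment> \<open>A single test function is extended by zero to a family, so that the bound on the
    sum applies.\<close>
  let ?F = "\<lambda>k. if k = j then F else (\<lambda>z. 0)"
  have "(score j F)\<^sup>2 = (score j (?F j))\<^sup>2" by simp
  also have "\<dots> \<le> (\<Sum>k\<in>J. (score k (?F k))\<^sup>2)"
    using finite_J assms(1) by (intro member_le_sum) auto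
  also have "\<dots> \<le> (sinh \<alpha>)\<^sup>2 * \<kappa>"
    using assms second_moment_cmult[of 0]
    by (intro sum_score_squares_le) (auto intro: bounded_measurable_const)
  finally show ?thesis .
qed

text \<open>A function with vanishing second moment may be multiplied by any constant and stays
  admissible, while its score grows linearly; a nonzero score would exceed the uniform bound. The
  factor \<open>r\<close> brings the score just above it. This settles the case in which
  normalization would divide by zero.\<close>

lemma score_zero:
  assumes "j \<in> J" "bounded_measurable Z F" "second_moment F = 0"
  shows "score j F = 0"
proof (rule ccontr)
  assume A: "score j F \<noteq> 0"
  define r where "r = (\<bar>sinh \<alpha>\<bar> * sqrt \<kappa> + 1) / score j F"
  have "(score j (\<lambda>z. r * F z))\<^sup>2 \<le> (sinh \<alpha>)\<^sup>2 * \<kappa>"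
    using assms by (intro score_square_le) (auto intro: bounded_measurable_mult bounded_measurable_const simp: second_moment_cmult)
  also have "\<dots> = (\<bar>sinh \<alpha>\<bar> * sqrt \<kappa>)\<^sup>2"
    using \<kappa>_pos by (simp add: power_mult_distrib)
  finally have "(\<bar>sinh \<alpha>\<bar> * sqrt \<kappa> + 1)\<^sup>2 \<le> (\<bar>sinh \<alpha>\<bar> * sqrt \<kappa>)\<^sup>2"
    using A unfolding score_cmult by (simp add: r_def)
  moreover have "0 \<le> \<bar>sinh \<alpha>\<bar> * sqrt \<kappa>" using \<kappa>_pos by simp
  ultimately show False
    using power2_le_imp_le by fastforce
qed

text \<open>Variational form of the chi-square divergence between the perturbed and the unperturbed
  output law.\<close>

definition score_bound :: "'j \<Rightarrow> real" where
  "score_bound j = (SUP F\<in>{F. bounded_measurable Z F \<and> second_moment F \<le> 1}. (score j F)\<^sup>2)"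

lemma score_bdd_above:
  "j \<in> J \<Longrightarrow> bdd_above ((\<lambda>F. (score j F)\<^sup>2) ` {F. bounded_measurable Z F \<and> second_moment F \<le> 1})"
  by (intro bdd_aboveI[where M="(sinh \<alpha>)\<^sup>2 * \<kappa>"]) (auto intro: score_square_le)

lemma zero_admissible: "(\<lambda>z. 0) \<in> {F. bounded_measurable Z F \<and> second_moment F \<le> 1}"
  using second_moment_cmult[of 0] by (auto intro: bounded_measurable_const)

lemma score_bound_nonneg: "j \<in> J \<Longrightarrow> 0 \<le> score_bound j"
  unfolding score_bound_def by (rule cSUP_upper2[OF score_bdd_above zero_admissible]) auto

text \<open>The suprema need not be attained, so near-maximizers with error \<open>e\<close> are
  taken for all \<open>j\<close> independently; this is legitimate because
  \<open>sum_score_squares_le\<close> admits a different test function for each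
  \<open>j\<close>.\<close>

lemma sum_score_bounds: "(\<Sum>j\<in>J. score_bound j) \<le> (sinh \<alpha>)\<^sup>2 * \<kappa>"
proof -
  have *: "(\<Sum>j\<in>J. score_bound j) \<le> (sinh \<alpha>)\<^sup>2 * \<kappa> + real (card J) * e" if "0 < e" for e
  proof -
    have "\<exists>F. bounded_measurable Z F \<and> second_moment F \<le> 1 \<and> score_bound j - e < (score j F)\<^sup>2" if "j \<in> J" for j
      using less_cSUP_iff[OF _ score_bdd_above[OF that], of "score_bound j - e"] zero_admissible \<open>0 < e\<close>
      unfolding score_bound_def by (auto simp: less_diff_eq)
    then obtain F where F: "\<And>j. j \<in> J \<Longrightarrow> bounded_measurable Z (F j) \<and> second_moment (F j) \<le> 1 \<and>
        score_bound j - e < (score j (F j))\<^sup>2"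
      by metis
    have "(\<Sum>j\<in>J. score_bound j) \<le> (\<Sum>j\<in>J. (score j (F j))\<^sup>2 + e)"
      using F by (intro sum_mono) force
    also have "\<dots> \<le> (sinh \<alpha>)\<^sup>2 * \<kappa> + real (card J) * e"
      using F sum_score_squares_le[of F] by (simp add: sum.distrib)
    finally show ?thesis .
  qed
  show ?thesis
  proof (rule field_le_epsilon)
    fix e :: real assume "0 < e"
    then have "(\<Sum>j\<in>J. score_bound j) \<le> (sinh \<alpha>)\<^sup>2 * \<kappa> + real (card J) * (e / (real (card J) + 1))"
      by (intro *) auto
    also have "real (card J) * (e / (real (card J) + 1)) \<le> e"
      using \<open>0 < e\<close> by (simp add: field_simps)
    finally show "(\<Sum>j\<in>J. score_bound j) \<le> (sinh \<alpha>)\<^sup>2 * \<kappa> + e" by simp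
  qed
qed

lemma score_square_le_score_bound:
  assumes j: "j \<in> J" and F: "bounded_measurable Z F"
  shows "(score j F)\<^sup>2 \<le> score_bound j * second_moment F"
proof (cases "second_moment F = 0")
  case False
  then have pos: "0 < second_moment F" using second_moment_nonneg[of F] by simp
  define r where "r = 1 / sqrt (second_moment F)"
  have "(score j (\<lambda>z. r * F z))\<^sup>2 \<le> score_bound j"
    unfolding score_bound_def
  proof (rule cSUP_upper[OF _ score_bdd_above[OF j]])
    have "bounded_measurable Z (\<lambda>z. r * F z)"
      by (intro bounded_measurable_mult bounded_measurable_const F)
    moreover have "second_moment (\<lambda>z. r * F z) \<le> 1"
      unfolding second_moment_cmult using pos by (simp add: r_def power_divide)
    ultimately show "(\<lambda>z. r * F z) \<in> {F. bounded_measurable Z F \<and> second_moment F \<le> 1}" by simp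
  qed
  then show ?thesis
    using pos unfolding score_cmult by (simp add: power_mult_distrib r_def power_divide field_simps)
qed (use score_zero[OF j F] in simp)

text \<open>Since \<open>g j\<close> has mean zero, only the centred part of \<open>F\<close> contributes to the score; this
  yields the constant \<open>1 + score_bound j\<close> instead of \<open>(1 + \<surd>score_bound j)\<^sup>2\<close>.\<close>

lemma perturbed_second_moment:
  assumes j: "j \<in> J" and F: "bounded_measurable Z F"
  shows "(\<integral>x. (1 + g j x) * T F x \<partial>N)\<^sup>2 \<le> (1 + score_bound j) * second_moment F"
proof -
  define m where "m = (\<integral>x. T F x \<partial>N)"
  define G where "G z = F z + (- m)" for z
  note intros = bounded_measurable_const bounded_measurable_add bounded_measurable_mult F
  have bG: "bounded_measurable Z G" unfolding G_def by (intro intros)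
  have T1: "T (\<lambda>z. r) x = r" if "x \<in> space N" for r x
    using prob_space.prob_space[OF prob_space_K[OF that]] by (simp add: T_def)
  have TG: "T G x = T F x - m" if "x \<in> space N" for x
    unfolding G_def using T_add[OF F bounded_measurable_const that, of "- m"] T1[OF that] by simp
  have "score j G = (\<integral>x. g j x * T F x - g j x * m \<partial>N)"
    unfolding score_def by (intro Bochner_Integration.integral_cong refl) (simp add: TG algebra_simps)
  also have "\<dots> = score j F"
    using j by (subst Bochner_Integration.integral_diff)
      (auto intro!: integrable_mult_T F g_integrable simp: g_mean score_def)
  finally have scG: "score j G = score j F" .
  have "T (\<lambda>z. G z * G z) x = T (\<lambda>z. F z * F z) x + (- 2 * m) * T F x + m\<^sup>2" if "x \<in> space N" for x
  proof -
    have "T (\<lambda>z. G z * G z) x = T (\<lambda>z. (F z * F z + (- 2 * m) * F z) + m\<^sup>2) x"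
      by (simp add: G_def algebra_simps power2_eq_square)
    also have "\<dots> = T (\<lambda>z. F z * F z + (- 2 * m) * F z) x + m\<^sup>2"
    proof -
      have "bounded_measurable Z (\<lambda>z. F z * F z + (- 2 * m) * F z)" by (intro intros)
      from T_add[OF this bounded_measurable_const that] show ?thesis by (simp only: T1[OF that])
    qed
    also have "T (\<lambda>z. F z * F z + (- 2 * m) * F z) x = T (\<lambda>z. F z * F z) x + T (\<lambda>z. (- 2 * m) * F z) x"
      by (intro T_add intros that)
    finally show ?thesis unfolding T_cmult .
  qed
  then have "second_moment G = (\<integral>x. T (\<lambda>z. F z * F z) x + (- 2 * m) * T F x + m\<^sup>2 \<partial>N)"
    unfolding second_moment_def by (intro Bochner_Integration.integral_cong refl)
  also have "\<dots> = second_moment F + (- 2 * m) * m + m\<^sup>2"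
    using integrable_T[OF F] integrable_T[OF bounded_measurable_mult[OF F F]]
    by (simp add: second_moment_def m_def prob_space)
  finally have smG: "second_moment G = second_moment F - m\<^sup>2" by (simp add: power2_eq_square)
  have mean: "(\<integral>x. (1 + g j x) * T F x \<partial>N) = m + score j F"
    unfolding m_def score_def using integrable_T[OF F] integrable_mult_T[OF g_integrable[OF j] F]
    by (simp add: distrib_right)
  define b where "b = sqrt (score_bound j) * sqrt (second_moment F - m\<^sup>2)"
  have V0: "0 \<le> second_moment F - m\<^sup>2"
    using second_moment_nonneg[of G] unfolding smG .
  have "(score j F)\<^sup>2 \<le> score_bound j * (second_moment F - m\<^sup>2)"
    using score_square_le_score_bound[OF j bG] unfolding scG smG .
  then have "\<bar>score j F\<bar> \<le> b"
    unfolding b_def real_sqrt_mult[symmetric] by (intro real_le_rsqrt) simp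
  then have "\<bar>m + score j F\<bar> \<le> \<bar>\<bar>m\<bar> + b\<bar>" by linarith
  then have "(m + score j F)\<^sup>2 \<le> (\<bar>m\<bar> + b)\<^sup>2"
    by (simp only: abs_le_square_iff)
  also have "\<dots> \<le> (1 + score_bound j) * second_moment F"
  proof -
    \<comment> \<open>Cauchy-Schwarz in the plane, for the vectors (1, sqrt of
      \<open>score_bound j\<close>) and (absolute mean, standard deviation), written as the square
      that is its defect.\<close>
    have "0 \<le> (sqrt (score_bound j) * \<bar>m\<bar> - sqrt (second_moment F - m\<^sup>2))\<^sup>2" by simp
    then show ?thesis
      using V0 score_bound_nonneg[OF j]
      by (simp add: b_def power2_sum power2_diff power_mult_distrib algebra_simps)
  qed
  finally show ?thesis unfolding mean .
qed

end

section \<open>The noise: likelihood ratios of shifts, size of the curvature constant, mass near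
  zero\<close>

text \<open>Positivity of \<open>p\<close> makes all shifted laws comparable by finite likelihood
  ratios; continuity bounds the density from below near 0.\<close>

locale noise =
  fixes c_plus :: real and p :: "real \<Rightarrow> real" and \<nu> :: "real measure"
  assumes p_pos: "\<And>x. 0 < p x"
    and p_continuous: "continuous_on UNIV p"
    and curvature: "curvature_le c_plus (\<lambda>x. - ln (p x))"
    and \<nu>_density: "\<nu> = density lborel (\<lambda>x. ennreal (p x))"
    and prob_\<nu>: "prob_space \<nu>"
    and \<nu>_symmetric: "distr \<nu> borel uminus = \<nu>"
    and \<nu>_variance: "prob_space.variance \<nu> (\<lambda>x. x) = 1"
begin

definition likelihood_ratio :: "real \<Rightarrow> real \<Rightarrow> real" where
  "likelihood_ratio h x = p (x - h) / p x"

lemma p_nonneg: "0 \<le> p x"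
  using p_pos[of x] by simp

lemma p_measurable [measurable]: "p \<in> borel_measurable borel"
  using p_continuous by (rule borel_measurable_continuous_onI)

lemma likelihood_ratio_measurable [measurable]: "likelihood_ratio h \<in> borel_measurable borel"
  unfolding likelihood_ratio_def by measurable

lemma likelihood_ratio_nonneg: "0 \<le> likelihood_ratio h x"
  unfolding likelihood_ratio_def using p_nonneg by simp

lemma sets_\<nu> [measurable_cong, simp]: "sets \<nu> = sets borel" and space_\<nu> [simp]: "space \<nu> = UNIV"
  by (simp_all add: \<nu>_density)

lemma nn_integral_shift:
  assumes [measurable]: "f \<in> borel_measurable borel"
  shows "(\<integral>\<^sup>+x. f (x + h) \<partial>\<nu>) = (\<integral>\<^sup>+x. f x * ennreal (likelihood_ratio h x) \<partial>\<nu>)"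
proof -
  have "(\<integral>\<^sup>+x. f x * ennreal (likelihood_ratio h x) \<partial>\<nu>) = (\<integral>\<^sup>+x. ennreal (p (x - h)) * f x \<partial>lborel)"
    unfolding \<nu>_density
  proof (subst nn_integral_density)
    have "ennreal (p x) * (f x * ennreal (likelihood_ratio h x)) = ennreal (p (x - h)) * f x" for x
    proof -
      have "ennreal (p x) * ennreal (likelihood_ratio h x) = ennreal (p (x - h))"
        using p_pos[of x] p_nonneg by (simp add: likelihood_ratio_def flip: ennreal_mult)
      then show ?thesis by (metis mult.assoc mult.commute)
    qed
    then show "(\<integral>\<^sup>+x. ennreal (p x) * (f x * ennreal (likelihood_ratio h x)) \<partial>lborel) =
        (\<integral>\<^sup>+x. ennreal (p (x - h)) * f x \<partial>lborel)" by simp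
  qed measurable
  also have "\<dots> = (\<integral>\<^sup>+x. ennreal (p x) * f (x + h) \<partial>lborel)"
    by (subst nn_integral_real_affine[where c=1 and t=h]) (auto simp: add.commute)
  also have "\<dots> = (\<integral>\<^sup>+x. f (x + h) \<partial>\<nu>)"
    unfolding \<nu>_density by (subst nn_integral_density) auto
  finally show ?thesis ..
qed

lemma integral_shift:
  fixes f :: "real \<Rightarrow> real"
  assumes [measurable]: "f \<in> borel_measurable borel"
  shows "integrable \<nu> (\<lambda>x. f x * likelihood_ratio h x) \<longleftrightarrow> integrable \<nu> (\<lambda>x. f (x + h))"
    and "(\<integral>x. f x * likelihood_ratio h x \<partial>\<nu>) = (\<integral>x. f (x + h) \<partial>\<nu>)"
proof -
  have eq: "p x * (f x * likelihood_ratio h x) = p (x - h) * f x" for x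
    using p_pos[of x] by (simp add: likelihood_ratio_def)
  show "integrable \<nu> (\<lambda>x. f x * likelihood_ratio h x) \<longleftrightarrow> integrable \<nu> (\<lambda>x. f (x + h))"
    unfolding \<nu>_density using lborel_integrable_real_affine_iff[of 1 "\<lambda>x. p (x - h) * f x" h]
    by (subst (1 2) integrable_density) (auto simp: eq p_nonneg add.commute)
  show "(\<integral>x. f x * likelihood_ratio h x \<partial>\<nu>) = (\<integral>x. f (x + h) \<partial>\<nu>)"
    unfolding \<nu>_density using lborel_integral_real_affine[of 1 "\<lambda>x. p (x - h) * f x" h]
    by (subst (1 2) integral_density) (auto simp: eq p_nonneg add.commute)
qed

text \<open>Midpoint curvature: \<open>x - h\<close> is the midpoint of \<open>x\<close> and \<open>x - 2 h\<close>.\<close>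

lemma p_midpoint: "(p (x - h))\<^sup>2 \<le> exp (c_plus * h\<^sup>2) * (p x * p (x - 2 * h))"
proof -
  have "- ln (p ((1/2) * x + (1 - 1/2) * (x - 2 * h))) -
      ((1/2) * - ln (p x) + (1 - 1/2) * - ln (p (x - 2 * h))) \<ge>
      - (c_plus / 2) * (1/2) * (1 - 1/2) * (x - (x - 2 * h))\<^sup>2"
    by (rule bspec[OF spec[OF spec[OF curvature[unfolded curvature_le_def], of x], of "x - 2 * h"], of "1/2"]) simp
  moreover have "(1/2) * x + (1 - 1/2) * (x - 2 * h) = x - h" by (simp add: field_simps)
  ultimately have "2 * ln (p (x - h)) \<le> c_plus * h\<^sup>2 + (ln (p x) + ln (p (x - 2 * h)))"
    by (simp add: power_mult_distrib)
  then have "exp (2 * ln (p (x - h))) \<le> exp (c_plus * h\<^sup>2 + (ln (p x) + ln (p (x - 2 * h))))"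
    by simp
  then show ?thesis
    by (simp add: exp_add exp_double p_pos)
qed

text \<open>Trades the square of a ratio for the ratio of the doubled shift, which is known to
  integrate to 1. The resulting second moment bound is the exact value for Gaussian noise of
  variance 1 / c_plus.\<close>

lemma likelihood_ratio_square_le:
  "(likelihood_ratio h x)\<^sup>2 \<le> exp (c_plus * h\<^sup>2) * likelihood_ratio (2 * h) x"
proof -
  have "(likelihood_ratio h x)\<^sup>2 * (p x)\<^sup>2 \<le> (exp (c_plus * h\<^sup>2) * likelihood_ratio (2 * h) x) * (p x)\<^sup>2"
    using p_midpoint[of x h] p_pos[of x] by (simp add: likelihood_ratio_def power_divide power2_eq_square mult_ac)
  then show ?thesis
    using p_pos[of x] by (simp add: mult_le_cancel_right)
qed

lemma likelihood_ratio_integrable: "integrable \<nu> (likelihood_ratio h)"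
  and integral_likelihood_ratio: "(\<integral>x. likelihood_ratio h x \<partial>\<nu>) = 1"
proof -
  interpret prob_space \<nu> by (rule prob_\<nu>)
  show "integrable \<nu> (likelihood_ratio h)" "(\<integral>x. likelihood_ratio h x \<partial>\<nu>) = 1"
    using integral_shift[of "\<lambda>x. 1" h] prob_space by auto
qed

lemma likelihood_ratio_square_integrable: "integrable \<nu> (\<lambda>x. (likelihood_ratio h x)\<^sup>2)"
proof (rule Bochner_Integration.integrable_bound)
  show "integrable \<nu> (\<lambda>x. exp (c_plus * h\<^sup>2) * likelihood_ratio (2 * h) x)"
    by (intro integrable_mult_right likelihood_ratio_integrable)
qed (use likelihood_ratio_square_le likelihood_ratio_nonneg in auto)

definition score_fun :: "real \<Rightarrow> real \<Rightarrow> real" where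
  "score_fun h x = likelihood_ratio h x - 1"

lemma score_fun_measurable [measurable]: "score_fun h \<in> borel_measurable borel"
  unfolding score_fun_def by measurable

lemma score_fun_integrable: "integrable \<nu> (score_fun h)"
  and integral_score_fun: "(\<integral>x. score_fun h x \<partial>\<nu>) = 0"
proof -
  interpret prob_space \<nu> by (rule prob_\<nu>)
  show "integrable \<nu> (score_fun h)" "(\<integral>x. score_fun h x \<partial>\<nu>) = 0"
    unfolding score_fun_def using likelihood_ratio_integrable integral_likelihood_ratio prob_space by auto
qed

lemma score_fun_square_integrable: "integrable \<nu> (\<lambda>x. (score_fun h x)\<^sup>2)"
  and integral_score_fun_square: "(\<integral>x. (score_fun h x)\<^sup>2 \<partial>\<nu>) \<le> exp (c_plus * h\<^sup>2) - 1"
proof -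
  interpret prob_space \<nu> by (rule prob_\<nu>)
  have eq: "(score_fun h x)\<^sup>2 = (likelihood_ratio h x)\<^sup>2 - 2 * likelihood_ratio h x + 1" for x
    by (simp add: score_fun_def power2_diff)
  note ints = likelihood_ratio_square_integrable[of h] likelihood_ratio_integrable
  show "integrable \<nu> (\<lambda>x. (score_fun h x)\<^sup>2)"
    unfolding eq using ints by auto
  have "(\<integral>x. (likelihood_ratio h x)\<^sup>2 \<partial>\<nu>) \<le> (\<integral>x. exp (c_plus * h\<^sup>2) * likelihood_ratio (2 * h) x \<partial>\<nu>)"
    by (intro integral_mono ints integrable_mult_right likelihood_ratio_square_le)
  then show "(\<integral>x. (score_fun h x)\<^sup>2 \<partial>\<nu>) \<le> exp (c_plus * h\<^sup>2) - 1"
    unfolding eq using ints integral_likelihood_ratio prob_space by simp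
qed

text \<open>Cauchy--Schwarz: shifting the noise by \<open>1\<close> moves its mean by \<open>1\<close>, i.e. by one standard
  deviation, so the \<open>\<chi>\<^sup>2\<close>-divergence of the shift is at least \<open>1\<close>.\<close>

lemma exp_c_plus_ge_2: "2 \<le> exp c_plus"
proof -
  interpret prob_space \<nu> by (rule prob_\<nu>)
  define m where "m = (\<integral>x. x \<partial>\<nu>)"
  have var: "(\<integral>x. (x - m)\<^sup>2 \<partial>\<nu>) = 1" using \<nu>_variance unfolding m_def .
  \<comment> \<open>A non-integrable function has integral 0 by convention, so variance 1 already
    implies a finite second moment.\<close>
  then have int2: "integrable \<nu> (\<lambda>x. (x - m)\<^sup>2)"
    using not_integrable_integral_eq by force
  have int1: "integrable \<nu> (\<lambda>x. x - m)"
    by (rule square_integrable_imp_integrable[OF _ int2]) simp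
  have prod: "integrable \<nu> (\<lambda>x. (x - m) * score_fun 1 x)"
    by (rule integrable_mult_square_integrable[OF _ _ int2 score_fun_square_integrable]) simp_all
  have "integrable \<nu> (\<lambda>x. x - m + 1)"
    using int1 by simp
  then have lr: "integrable \<nu> (\<lambda>x. (x - m) * likelihood_ratio 1 x)"
    "(\<integral>x. (x - m) * likelihood_ratio 1 x \<partial>\<nu>) = (\<integral>x. x - m + 1 \<partial>\<nu>)"
    using integral_shift[of "\<lambda>x. x - m" 1] by (auto simp: algebra_simps)
  have "(\<integral>x. (x - m) * score_fun 1 x \<partial>\<nu>) =
      (\<integral>x. (x - m) * likelihood_ratio 1 x - (x - m) \<partial>\<nu>)"
    by (simp add: score_fun_def algebra_simps)
  also have "\<dots> = 1"
    using lr int1 prob_space by (subst Bochner_Integration.integral_diff) auto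
  finally have one: "(\<integral>x. (x - m) * score_fun 1 x \<partial>\<nu>) = 1" .
  have "2 * 1 = (\<integral>x. 2 * ((x - m) * score_fun 1 x) \<partial>\<nu>)"
    using one by simp
  also have "\<dots> \<le> (\<integral>x. (x - m)\<^sup>2 + (score_fun 1 x)\<^sup>2 \<partial>\<nu>)"
    by (intro integral_mono Bochner_Integration.integrable_add integrable_mult_right
        int2 prod score_fun_square_integrable)
      (simp only: mult.assoc[symmetric] sum_squares_bound)
  also have "\<dots> = 1 + (\<integral>x. (score_fun 1 x)\<^sup>2 \<partial>\<nu>)"
    using int2 score_fun_square_integrable var by simp
  also have "\<dots> \<le> 1 + (exp (c_plus * 1\<^sup>2) - 1)"
    by (intro add_left_mono integral_score_fun_square)
  finally show ?thesis by simp
qed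

text \<open>Below 1/2, the square of \<open>exp c_plus\<close> would be less than e, hence less than
  4. The bound prevents the critical signal, which carries 1 / L, from growing too large when c_plus
  is small.\<close>

lemma c_plus_ge_half: "1 / 2 \<le> c_plus"
proof (rule ccontr)
  assume "\<not> 1 / 2 \<le> c_plus"
  then have "(exp c_plus)\<^sup>2 < exp 1" by (simp flip: exp_double)
  moreover have "2\<^sup>2 \<le> (exp c_plus)\<^sup>2" using exp_c_plus_ge_2 by (intro power_mono) auto
  ultimately show False using exp_le by simp
qed

text \<open>A positive continuous density is bounded below on [-1,1] by its minimum there, so short
  symmetric intervals have mass at least linear in their length; \<kappa> is twice that
  minimum.\<close>

lemma interval_mass:
  obtains \<kappa> where "0 < \<kappa>" "\<And>u. 0 < u \<Longrightarrow> \<kappa> * min u 1 \<le> measure \<nu> {-u<..<u}"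
proof -
  interpret prob_space \<nu> by (rule prob_\<nu>)
  obtain x0 where x0: "x0 \<in> {-1..1}" "\<And>x. x \<in> {-1..1} \<Longrightarrow> p x0 \<le> p x"
    using continuous_attains_inf[of "{-1..1::real}" p] continuous_on_subset[OF p_continuous] by auto
  have "2 * p x0 * min u 1 \<le> measure \<nu> {-u<..<u}" if "0 < u" for u
  proof -
    define v where "v = min u 1"
    have v: "0 < v" "v \<le> 1" "v \<le> u" using that by (auto simp: v_def)
    have "ennreal (2 * p x0 * v) = ennreal (p x0) * emeasure lborel {-v<..<v}"
      using v p_nonneg by (simp add: mult_ac flip: ennreal_mult)
    also have "\<dots> = (\<integral>\<^sup>+x. ennreal (p x0) * indicator {-v<..<v} x \<partial>lborel)"
      by (subst nn_integral_cmult_indicator) auto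
    also have "\<dots> \<le> (\<integral>\<^sup>+x. ennreal (p x) * indicator {-u<..<u} x \<partial>lborel)"
      using v x0(2) by (intro nn_integral_mono) (auto split: split_indicator intro!: ennreal_leI)
    also have "\<dots> = emeasure \<nu> {-u<..<u}"
      unfolding \<nu>_density by (subst emeasure_density) auto
    finally show ?thesis
      using measure_nonneg by (simp add: emeasure_eq_measure v_def)
  qed
  moreover have "0 < 2 * p x0" using p_pos by simp
  ultimately show ?thesis using that by blast
qed

text \<open>The left side is the mean of the sign of a noise coordinate shifted by \<open>u\<close>.
  By symmetry the two outer tails cancel.\<close>

lemma tail_difference:
  assumes "0 \<le> u"
  shows "measure \<nu> {-u<..} - measure \<nu> {..-u} = measure \<nu> {-u<..<u}"
proof -
  interpret prob_space \<nu> by (rule prob_\<nu>)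
  have "measure \<nu> {..-u} = measure (distr \<nu> borel uminus) {..-u}"
    by (simp add: \<nu>_symmetric)
  also have "\<dots> = measure \<nu> {u..}"
    by (subst measure_distr) (auto intro!: arg_cong[where f="measure \<nu>"])
  finally have sym: "measure \<nu> {..-u} = measure \<nu> {u..}" .
  show ?thesis
  \<comment> \<open>At \<open>u = 0\<close> the interval is empty and cannot be glued to the
    half-line starting at \<open>u\<close>; the point 0 is left over and must be shown to have no
    mass.\<close>
  proof (cases "u = 0")
    case True
    have "emeasure \<nu> {0} = 0"
      unfolding \<nu>_density by (subst emeasure_density) (auto simp: nn_integral_indicator_singleton)
    then have "measure \<nu> {0} = 0" by (simp add: emeasure_eq_measure)
    moreover have "measure \<nu> {0..} = measure \<nu> {0} + measure \<nu> {0<..}"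
      by (subst finite_measure_Union[symmetric]) (auto intro!: arg_cong[where f="measure \<nu>"])
    ultimately show ?thesis using True sym by simp
  next
    case False
    have "measure \<nu> {-u<..} = measure \<nu> {-u<..<u} + measure \<nu> {u..}"
      using assms False by (subst finite_measure_Union[symmetric]) (auto intro!: arg_cong[where f="measure \<nu>"])
    then show ?thesis using sym by simp
  qed
qed

end

section \<open>One user: a zero signal against d spikes\<close>

definition spike :: "nat \<Rightarrow> real \<Rightarrow> nat \<Rightarrow> nat \<Rightarrow> real" where
  "spike d a j = (\<lambda>k\<in>{..<d}. if k = j then a else 0)"

definition zero_vec :: "nat \<Rightarrow> nat \<Rightarrow> real" where
  "zero_vec d = (\<lambda>k\<in>{..<d}. 0)"

context noise
begin

abbreviation noise_vec :: "nat \<Rightarrow> (nat \<Rightarrow> real) measure" where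
  "noise_vec d \<equiv> (\<Pi>\<^sub>M j\<in>{..<d}. \<nu>)"

lemma prob_noise_vec: "prob_space (noise_vec d)"
  by (intro prob_space_PiM prob_\<nu>)

lemma sets_noise_vec: "sets (noise_vec d) = sets (RV d)"
  by (intro sets_PiM_cong) auto

lemma measurable_noise_vec_iff: "f \<in> noise_vec d \<rightarrow>\<^sub>M M \<longleftrightarrow> f \<in> RV d \<rightarrow>\<^sub>M M"
  using measurable_cong_sets[OF sets_noise_vec refl] by blast

lemma noise_coordinate:
  fixes f :: "real \<Rightarrow> real"
  assumes "j < d" and [measurable]: "f \<in> borel_measurable borel"
  shows "integrable (noise_vec d) (\<lambda>\<xi>. f (\<xi> j)) \<longleftrightarrow> integrable \<nu> f"
    and "(\<integral>\<xi>. f (\<xi> j) \<partial>noise_vec d) = (\<integral>x. f x \<partial>\<nu>)"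
proof -
  have *: "distr (noise_vec d) \<nu> (\<lambda>\<xi>. \<xi> j) = \<nu>"
    using assms by (intro distr_PiM_component prob_\<nu>) auto
  have [measurable]: "(\<lambda>\<xi>. \<xi> j) \<in> noise_vec d \<rightarrow>\<^sub>M \<nu>"
    using assms by (intro measurable_component_singleton) auto
  have [measurable]: "f \<in> borel_measurable \<nu>" by measurable
  show "integrable (noise_vec d) (\<lambda>\<xi>. f (\<xi> j)) \<longleftrightarrow> integrable \<nu> f"
    by (subst (2) *[symmetric], subst integrable_distr_eq) auto
  show "(\<integral>\<xi>. f (\<xi> j) \<partial>noise_vec d) = (\<integral>x. f x \<partial>\<nu>)"
    by (subst (2) *[symmetric], subst integral_distr) auto
qed

lemma noise_coordinates_uncorrelated:
  fixes f :: "real \<Rightarrow> real"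
  assumes "j < d" "k < d" "j \<noteq> k" and "integrable \<nu> f"
  shows "(\<integral>\<xi>. f (\<xi> j) * f (\<xi> k) \<partial>noise_vec d) = (\<integral>x. f x \<partial>\<nu>) * (\<integral>x. f x \<partial>\<nu>)"
proof -
  interpret P: product_prob_space "\<lambda>_. \<nu>" "{..<d}"
    by (intro product_prob_spaceI prob_\<nu>)
  define F where "F i = (if i = j \<or> i = k then f else (\<lambda>x. 1))" for i
  have split: "(\<Prod>i<d. G i) = G j * G k" if "\<And>i. i \<noteq> j \<Longrightarrow> i \<noteq> k \<Longrightarrow> G i = 1" for G :: "nat \<Rightarrow> real"
  proof -
    have "(\<Prod>i<d. G i) = (\<Prod>i\<in>{j, k}. G i)"
      using assms that by (intro prod.mono_neutral_right) auto
    then show ?thesis using assms by simp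
  qed
  have "(\<integral>\<xi>. (\<Prod>i<d. F i (\<xi> i)) \<partial>noise_vec d) = (\<Prod>i<d. \<integral>x. F i x \<partial>\<nu>)"
    using assms by (intro P.product_integral_prod) (auto simp: F_def)
  then show ?thesis
    by (subst (asm) (1 2) split) (auto simp: F_def prob_space.prob_space[OF prob_\<nu>, simplified])
qed

text \<open>Fubini with coordinate \<open>j\<close> as inner integral reduces the claim to the shift
  on the line, so the likelihood ratio of a spike depends on that coordinate alone.\<close>

lemma nn_integral_noise_shift:
  assumes j: "j < d" and f: "f \<in> borel_measurable (noise_vec d)"
  shows "(\<integral>\<^sup>+\<xi>. f (\<xi>(j := \<xi> j + h)) \<partial>noise_vec d) =
    (\<integral>\<^sup>+\<xi>. f \<xi> * ennreal (likelihood_ratio h (\<xi> j)) \<partial>noise_vec d)"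
proof -
  interpret P: product_prob_space "\<lambda>_. \<nu>" "{..<d}"
    by (intro product_prob_spaceI prob_\<nu>)
  define I where "I = {..<d} - {j}"
  have I: "finite I" "j \<notin> I" "insert j I = {..<d}" using j by (auto simp: I_def)
  have comp: "(\<lambda>\<xi>. \<xi> j) \<in> borel_measurable (noise_vec d)"
    using measurable_component_singleton[of j "{..<d}" "\<lambda>_. \<nu>"] j
      measurable_cong_sets[OF refl sets_\<nu>] by auto
  have upd: "(\<lambda>\<xi>. \<xi>(j := \<xi> j + h)) \<in> noise_vec d \<rightarrow>\<^sub>M noise_vec d"
  proof (rule measurable_PiM_single')
    fix i assume i: "i \<in> {..<d}"
    have "(\<lambda>\<xi>. \<xi> i) \<in> borel_measurable (noise_vec d)"
      using measurable_component_singleton[of i "{..<d}" "\<lambda>_. \<nu>"] i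
        measurable_cong_sets[OF refl sets_\<nu>] by auto
    then show "(\<lambda>\<xi>. (\<xi>(j := \<xi> j + h)) i) \<in> noise_vec d \<rightarrow>\<^sub>M \<nu>"
      using measurable_cong_sets[OF refl sets_\<nu>] comp by (cases "i = j") auto
  qed (use j in \<open>auto simp: space_PiM PiE_def extensional_def\<close>)
  have fu: "(\<lambda>\<xi>. f (\<xi>(j := \<xi> j + h))) \<in> borel_measurable (noise_vec d)"
    by (rule measurable_compose[OF upd f])
  have fr: "(\<lambda>\<xi>. f \<xi> * ennreal (likelihood_ratio h (\<xi> j))) \<in> borel_measurable (noise_vec d)"
    using f measurable_compose[OF comp likelihood_ratio_measurable] by measurable
  have "(\<integral>\<^sup>+\<xi>. f (\<xi>(j := \<xi> j + h)) \<partial>noise_vec d) =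
      (\<integral>\<^sup>+x. \<integral>\<^sup>+y. f (x(j := y + h)) \<partial>\<nu> \<partial>PiM I (\<lambda>_. \<nu>))"
    using P.product_nn_integral_insert[OF I(1,2), unfolded I(3), OF fu] by simp
  also have "\<dots> = (\<integral>\<^sup>+x. \<integral>\<^sup>+y. f (x(j := y)) * ennreal (likelihood_ratio h y) \<partial>\<nu> \<partial>PiM I (\<lambda>_. \<nu>))"
  proof (rule nn_integral_cong)
    fix x assume x: "x \<in> space (PiM I (\<lambda>_. \<nu>))"
    have "(\<lambda>y. x(j := y)) \<in> \<nu> \<rightarrow>\<^sub>M noise_vec d"
      using measurable_component_update[OF x I(2)] unfolding I(3) .
    then have "(\<lambda>y. f (x(j := y))) \<in> borel_measurable \<nu>"
      using f by (rule measurable_compose)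
    then have "(\<lambda>y. f (x(j := y))) \<in> borel_measurable borel"
      using measurable_cong_sets[OF sets_\<nu> refl] by blast
    from nn_integral_shift[OF this]
    show "(\<integral>\<^sup>+y. f (x(j := y + h)) \<partial>\<nu>) = (\<integral>\<^sup>+y. f (x(j := y)) * ennreal (likelihood_ratio h y) \<partial>\<nu>)" .
  qed
  also have "\<dots> = (\<integral>\<^sup>+\<xi>. f \<xi> * ennreal (likelihood_ratio h (\<xi> j)) \<partial>noise_vec d)"
    using P.product_nn_integral_insert[OF I(1,2), unfolded I(3), OF fr] by simp
  finally show ?thesis .
qed

text \<open>The observation under zero signal as a function of the standard noise. Spikes become
  reweightings of the noise law, and \<sigma> moves into the channel.\<close>

definition scale :: "real \<Rightarrow> nat \<Rightarrow> (nat \<Rightarrow> real) \<Rightarrow> nat \<Rightarrow> real" where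
  "scale \<sigma> d \<xi> = (\<lambda>k\<in>{..<d}. \<sigma> * \<xi> k)"

lemma affine_measurable:
  "(\<lambda>\<xi>. \<lambda>k\<in>{..<d}. \<theta> k + \<sigma> * \<xi> k) \<in> noise_vec d \<rightarrow>\<^sub>M RV d"
  unfolding measurable_noise_vec_iff by measurable

lemma scale_measurable: "scale \<sigma> d \<in> noise_vec d \<rightarrow>\<^sub>M RV d"
  unfolding scale_def measurable_noise_vec_iff by measurable

lemma obs_law_in_prob_algebra: "obs_law \<nu> \<sigma> d \<theta> \<in> space (prob_algebra (RV d))"
  unfolding obs_law_def space_prob_algebra
  using prob_space.prob_space_distr[OF prob_noise_vec affine_measurable] by simp

lemma nn_integral_obs_law:
  "f \<in> borel_measurable (RV d) \<Longrightarrow>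
    (\<integral>\<^sup>+x. f x \<partial>obs_law \<nu> \<sigma> d \<theta>) = (\<integral>\<^sup>+\<xi>. f (\<lambda>k\<in>{..<d}. \<theta> k + \<sigma> * \<xi> k) \<partial>noise_vec d)"
  unfolding obs_law_def by (subst nn_integral_distr[OF affine_measurable]) simp_all

lemma nn_integral_obs_law_zero:
  "f \<in> borel_measurable (RV d) \<Longrightarrow>
    (\<integral>\<^sup>+x. f x \<partial>obs_law \<nu> \<sigma> d (zero_vec d)) = (\<integral>\<^sup>+\<xi>. f (scale \<sigma> d \<xi>) \<partial>noise_vec d)"
  by (subst nn_integral_obs_law)
    (auto intro!: nn_integral_cong arg_cong[of _ _ f] simp: zero_vec_def scale_def)

lemma nn_integral_obs_law_spike:
  assumes f: "f \<in> borel_measurable (RV d)" and j: "j < d"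
  shows "(\<integral>\<^sup>+x. f x \<partial>obs_law \<nu> \<sigma> d (spike d (\<sigma> * h) j)) =
    (\<integral>\<^sup>+\<xi>. f (scale \<sigma> d \<xi>) * ennreal (likelihood_ratio h (\<xi> j)) \<partial>noise_vec d)"
proof -
  have "(\<integral>\<^sup>+x. f x \<partial>obs_law \<nu> \<sigma> d (spike d (\<sigma> * h) j)) =
      (\<integral>\<^sup>+\<xi>. f (scale \<sigma> d (\<xi>(j := \<xi> j + h))) \<partial>noise_vec d)"
    unfolding nn_integral_obs_law[OF f]
    by (intro nn_integral_cong arg_cong[of _ _ f]) (auto simp: spike_def scale_def algebra_simps)
  also have "\<dots> = (\<integral>\<^sup>+\<xi>. f (scale \<sigma> d \<xi>) * ennreal (likelihood_ratio h (\<xi> j)) \<partial>noise_vec d)"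
    by (rule nn_integral_noise_shift[OF j measurable_compose[OF scale_measurable f]])
  finally show ?thesis .
qed

end

text \<open>The iterated integral is identified among nonnegative integrals, where no integrability
  is at stake; since \<open>F\<close> is bounded and \<open>G\<close> integrable, the equality then
  passes to real integrals.\<close>

lemma integral_bind_eqI:
  fixes F :: "'b \<Rightarrow> real" and G :: "'c \<Rightarrow> real"
  assumes M: "M \<in> space (prob_algebra X)" and K: "K \<in> X \<rightarrow>\<^sub>M prob_algebra Z"
    and F: "F \<in> borel_measurable Z" "\<And>z. 0 \<le> F z \<and> F z \<le> 1"
    and G: "integrable N G" "\<And>x. x \<in> space N \<Longrightarrow> 0 \<le> G x"
    and eq: "(\<integral>\<^sup>+x. \<integral>\<^sup>+z. ennreal (F z) \<partial>K x \<partial>M) = (\<integral>\<^sup>+x. ennreal (G x) \<partial>N)"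
  shows "(\<integral>z. F z \<partial>(M \<bind> K)) = (\<integral>x. G x \<partial>N)"
proof -
  have setsM: "sets M = sets X" using M by (simp add: space_prob_algebra)
  have Fm: "F \<in> borel_measurable (M \<bind> K)"
    using F(1) measurable_cong_sets[OF sets_bind'[OF M K] refl] by blast
  have "ennreal (\<integral>z. F z \<partial>(M \<bind> K)) = (\<integral>\<^sup>+z. ennreal (F z) \<partial>(M \<bind> K))"
    using F by (intro nn_integral_eq_integral[symmetric] integrable_unit_interval prob_space_bind'[OF M K] Fm) auto
  also have "\<dots> = (\<integral>\<^sup>+x. \<integral>\<^sup>+z. ennreal (F z) \<partial>K x \<partial>M)"
    using F(1) measurable_prob_algebraD[OF K] measurable_cong_sets[OF setsM refl]
    by (intro nn_integral_bind[where B=Z]) auto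
  also have "\<dots> = ennreal (\<integral>x. G x \<partial>N)"
    unfolding eq using G by (intro nn_integral_eq_integral) auto
  finally show ?thesis
    using F G by (subst (asm) ennreal_inj) (auto intro!: Bochner_Integration.integral_nonneg_AE AE_I2)
qed

context noise
begin

text \<open>The numbers \<open>D j\<close> are the chi-square divergences of this user's outputs.
  They depend on the mechanism, hence the existential form, but the bound on their sum does
  not.\<close>

lemma user_second_moments:
  assumes Q: "Q \<in> RV d \<rightarrow>\<^sub>M prob_algebra (RV d)"
    and ratio: "\<And>A x x'. A \<in> sets (RV d) \<Longrightarrow> x \<in> space (RV d) \<Longrightarrow> x' \<in> space (RV d) \<Longrightarrow>
      measure (Q x) A \<le> exp \<alpha> * measure (Q x') A"
    and h: "0 < h"
  shows "\<exists>D. (\<forall>j<d. 0 \<le> D j) \<and> (\<Sum>j<d. D j) \<le> (sinh \<alpha>)\<^sup>2 * (exp (c_plus * h\<^sup>2) - 1) \<and>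
    (\<forall>j<d. \<forall>F\<in>borel_measurable (RV d). (\<forall>z. 0 \<le> F z \<and> F z \<le> (1::real)) \<longrightarrow>
      (\<integral>z. F z \<partial>(obs_law \<nu> \<sigma> d (spike d (\<sigma> * h) j) \<bind> Q))\<^sup>2 \<le>
      (1 + D j) * (\<integral>z. (F z)\<^sup>2 \<partial>(obs_law \<nu> \<sigma> d (zero_vec d) \<bind> Q)))"
proof -
  define \<kappa> where "\<kappa> = exp (c_plus * h\<^sup>2) - 1"
  define K where "K \<xi> = Q (scale \<sigma> d \<xi>)" for \<xi>
  define g where "g j \<xi> = score_fun h (\<xi> j)" for j :: nat and \<xi> :: "nat \<Rightarrow> real"
  have scale_space: "scale \<sigma> d \<xi> \<in> space (RV d)" if "\<xi> \<in> space (noise_vec d)" for \<xi>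
    using measurable_space[OF scale_measurable that] .
  interpret N: prob_space "noise_vec d" by (rule prob_noise_vec)
  \<comment> \<open>Orthogonality of the scores is independence of the noise coordinates together
    with centring, since \<open>g j\<close> reads coordinate \<open>j\<close> only.\<close>
  interpret ldp_perturbations "noise_vec d" K "RV d" \<alpha> "{..<d}" g \<kappa>
  proof unfold_locales
    show "K \<in> noise_vec d \<rightarrow>\<^sub>M prob_algebra (RV d)"
      unfolding K_def by (rule measurable_compose[OF scale_measurable Q])
    show "measure (K x) A \<le> exp \<alpha> * measure (K x') A"
      if "A \<in> sets (RV d)" "x \<in> space (noise_vec d)" "x' \<in> space (noise_vec d)" for A x x'
      unfolding K_def using that by (intro ratio scale_space)
    show "0 < \<kappa>" unfolding \<kappa>_def using c_plus_ge_half h by simp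
    show "g j \<in> borel_measurable (noise_vec d)" if "j \<in> {..<d}" for j
      unfolding g_def measurable_noise_vec_iff using that
      by (intro measurable_compose[of "\<lambda>\<xi>. \<xi> j" "RV d" borel "score_fun h" borel]
          measurable_component_singleton score_fun_measurable)
    show "integrable (noise_vec d) (\<lambda>x. (g j x)\<^sup>2)" if "j \<in> {..<d}" for j
      unfolding g_def using that noise_coordinate(1)[of j d "\<lambda>x. (score_fun h x)\<^sup>2"] score_fun_square_integrable
      by simp
    show "(\<integral>x. g j x \<partial>noise_vec d) = 0" if "j \<in> {..<d}" for j
      unfolding g_def using that noise_coordinate(2)[of j d "score_fun h"] integral_score_fun by simp
    show "(\<integral>x. g j x * g k x \<partial>noise_vec d) = 0" if "j \<in> {..<d}" "k \<in> {..<d}" "j \<noteq> k" for j k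
      unfolding g_def using that noise_coordinates_uncorrelated[of j d k "score_fun h"]
        integral_score_fun score_fun_integrable by simp
    show "(\<integral>x. (g j x)\<^sup>2 \<partial>noise_vec d) \<le> \<kappa>" if "j \<in> {..<d}" for j
      unfolding g_def \<kappa>_def using that noise_coordinate(2)[of j d "\<lambda>x. (score_fun h x)\<^sup>2"] integral_score_fun_square
      by simp
  qed auto
  have inner: "(\<integral>\<^sup>+z. ennreal (F z) \<partial>K \<xi>) = ennreal (T F \<xi>)" "0 \<le> T F \<xi>"
    if "bounded_measurable (RV d) F" "\<And>z. 0 \<le> F z" "\<xi> \<in> space (noise_vec d)" for F \<xi>
    unfolding T_def using that integrable_K by (auto intro!: nn_integral_eq_integral)
  have bmI: "bounded_measurable (RV d) F" if "F \<in> borel_measurable (RV d)" "\<And>z. 0 \<le> F z \<and> F z \<le> 1" for F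
    unfolding bounded_measurable_def using that by (auto intro!: exI[of _ 1])
  have kernel_meas: "(\<lambda>x. \<integral>\<^sup>+z. ennreal (F z) \<partial>Q x) \<in> borel_measurable (RV d)"
    if "F \<in> borel_measurable (RV d)" for F
    using that measurable_compose[OF measurable_prob_algebraD[OF Q] nn_integral_measurable_subprob_algebra] by auto
  have spike: "(\<integral>z. F z \<partial>(obs_law \<nu> \<sigma> d (spike d (\<sigma> * h) j) \<bind> Q)) = (\<integral>\<xi>. (1 + g j \<xi>) * T F \<xi> \<partial>noise_vec d)"
    if j: "j < d" and F: "F \<in> borel_measurable (RV d)" "\<And>z. 0 \<le> F z \<and> F z \<le> 1" for F j
  proof (rule integral_bind_eqI[OF obs_law_in_prob_algebra Q F])
    note bF = bmI[OF F]
    have lr: "1 + g j \<xi> = likelihood_ratio h (\<xi> j)" for \<xi> by (simp add: g_def score_fun_def)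
    show "integrable (noise_vec d) (\<lambda>\<xi>. (1 + g j \<xi>) * T F \<xi>)"
      using j by (intro integrable_mult_T bF Bochner_Integration.integrable_add g_integrable) auto
    show "0 \<le> (1 + g j \<xi>) * T F \<xi>" if "\<xi> \<in> space (noise_vec d)" for \<xi>
      unfolding lr using inner(2)[OF bF _ that] F likelihood_ratio_nonneg by simp
    show "(\<integral>\<^sup>+x. \<integral>\<^sup>+z. ennreal (F z) \<partial>Q x \<partial>obs_law \<nu> \<sigma> d (spike d (\<sigma> * h) j)) =
        (\<integral>\<^sup>+\<xi>. ennreal ((1 + g j \<xi>) * T F \<xi>) \<partial>noise_vec d)"
      unfolding nn_integral_obs_law_spike[OF kernel_meas[OF F(1)] j] lr
      using inner[OF bF] F likelihood_ratio_nonneg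
      by (intro nn_integral_cong) (simp add: K_def[symmetric] ennreal_mult mult.commute)
  qed
  have zero: "(\<integral>z. F z \<partial>(obs_law \<nu> \<sigma> d (zero_vec d) \<bind> Q)) = (\<integral>\<xi>. T F \<xi> \<partial>noise_vec d)"
    if F: "F \<in> borel_measurable (RV d)" "\<And>z. 0 \<le> F z \<and> F z \<le> 1" for F
  proof (rule integral_bind_eqI[OF obs_law_in_prob_algebra Q F])
    note bF = bmI[OF F]
    show "integrable (noise_vec d) (T F)" by (rule integrable_T[OF bF])
    show "0 \<le> T F \<xi>" if "\<xi> \<in> space (noise_vec d)" for \<xi>
      using inner(2)[OF bF _ that] F by simp
    show "(\<integral>\<^sup>+x. \<integral>\<^sup>+z. ennreal (F z) \<partial>Q x \<partial>obs_law \<nu> \<sigma> d (zero_vec d)) =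
        (\<integral>\<^sup>+\<xi>. ennreal (T F \<xi>) \<partial>noise_vec d)"
      unfolding nn_integral_obs_law_zero[OF kernel_meas[OF F(1)]]
      using inner[OF bF] F by (intro nn_integral_cong) (simp add: K_def[symmetric])
  qed
  show ?thesis
  proof (intro exI[of _ score_bound] conjI allI impI ballI)
    show "0 \<le> score_bound j" if "j < d" for j using that by (simp add: score_bound_nonneg)
    show "(\<Sum>j<d. score_bound j) \<le> (sinh \<alpha>)\<^sup>2 * (exp (c_plus * h\<^sup>2) - 1)"
      using sum_score_bounds by (simp add: \<kappa>_def)
    fix j and F :: "(nat \<Rightarrow> real) \<Rightarrow> real"
    assume j: "j < d" and F: "F \<in> borel_measurable (RV d)" "\<forall>z. 0 \<le> F z \<and> F z \<le> 1"
    have F2: "(\<lambda>z. (F z)\<^sup>2) \<in> borel_measurable (RV d)" "0 \<le> (F z)\<^sup>2 \<and> (F z)\<^sup>2 \<le> 1" for z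
      using F by (auto simp: power_le_one)
    have "(\<integral>z. F z \<partial>(obs_law \<nu> \<sigma> d (spike d (\<sigma> * h) j) \<bind> Q))\<^sup>2 \<le> (1 + score_bound j) * second_moment F"
      using F by (subst spike) (auto intro!: perturbed_second_moment bmI j simp: j)
    then show "(\<integral>z. F z \<partial>(obs_law \<nu> \<sigma> d (spike d (\<sigma> * h) j) \<bind> Q))\<^sup>2 \<le>
        (1 + score_bound j) * (\<integral>z. (F z)\<^sup>2 \<partial>(obs_law \<nu> \<sigma> d (zero_vec d) \<bind> Q))"
      unfolding zero[OF F2] second_moment_def by (simp add: power2_eq_square)
  qed
qed

end

section \<open>Independent users: products of kernels and coordinatewise risk\<close>

lemma emeasure_PiM_box:
  assumes "\<And>i. i \<in> I \<Longrightarrow> prob_space (M i)" "finite I" "\<And>i. i \<in> I \<Longrightarrow> A i \<in> sets (M i)"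
  shows "emeasure (PiM I M) (Pi\<^sub>E I A) = (\<Prod>i\<in>I. emeasure (M i) (A i))"
  using emeasure_PiM_emb[OF assms(1) subset_refl assms(2,3)] assms(3)
  by (simp add: sets.sets_into_space)

lemma measurable_PiM_kernels:
  assumes K: "\<And>i. i \<in> I \<Longrightarrow> K i \<in> M i \<rightarrow>\<^sub>M prob_algebra (Z i)" and "finite I"
  shows "(\<lambda>x. PiM I (\<lambda>i. K i (x i))) \<in> PiM I M \<rightarrow>\<^sub>M prob_algebra (PiM I Z)"
proof (rule measurable_prob_algebra_generated[OF sets_PiM Int_stable_prod_algebra prod_algebra_sets_into_space])
  fix x assume x: "x \<in> space (PiM I M)"
  then have Kx: "K i (x i) \<in> space (prob_algebra (Z i))" if "i \<in> I" for i
    using K[OF that] that by (auto simp: space_PiM intro: measurable_space)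
  then show "prob_space (PiM I (\<lambda>i. K i (x i)))"
    by (intro prob_space_PiM) (auto simp: space_prob_algebra)
  show "sets (PiM I (\<lambda>i. K i (x i))) = sets (PiM I Z)"
    using Kx by (intro sets_PiM_cong) (auto simp: space_prob_algebra)
next
  fix A assume "A \<in> prod_algebra I Z"
  then obtain E where E: "A = Pi\<^sub>E I E" "\<And>i. i \<in> I \<Longrightarrow> E i \<in> sets (Z i)"
    using \<open>finite I\<close> by (auto simp: prod_algebra_eq_finite)
  have "emeasure (PiM I (\<lambda>i. K i (x i))) A = (\<Prod>i\<in>I. emeasure (K i (x i)) (E i))" if x: "x \<in> space (PiM I M)" for x
  proof -
    have Kx: "K i (x i) \<in> space (prob_algebra (Z i))" if "i \<in> I" for i
      using K[OF that] x that by (auto simp: space_PiM intro: measurable_space)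
    then show ?thesis
      unfolding E(1) using \<open>finite I\<close> E(2)
      by (intro emeasure_PiM_box) (auto simp: space_prob_algebra)
  qed
  moreover have "(\<lambda>x. \<Prod>i\<in>I. emeasure (K i (x i)) (E i)) \<in> borel_measurable (PiM I M)"
  proof (rule borel_measurable_prod_ennreal)
    fix i assume i: "i \<in> I"
    have "(\<lambda>y. emeasure (K i y) (E i)) \<in> borel_measurable (M i)"
      using measurable_compose[OF measurable_prob_algebraD[OF K[OF i]] measurable_emeasure_subprob_algebra[OF E(2)[OF i]]] .
    then show "(\<lambda>x. emeasure (K i (x i)) (E i)) \<in> borel_measurable (PiM I M)"
      by (rule measurable_compose[OF measurable_component_singleton[OF i]])
  qed
  ultimately show "(\<lambda>x. emeasure (PiM I (\<lambda>i. K i (x i))) A) \<in> borel_measurable (PiM I M)"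
    by (subst measurable_cong) auto
qed

text \<open>Non-interactivity in measure form: independent inputs sent through separate channels
  give independent outputs. A finite product measure is determined on boxes, where both sides
  factor.\<close>

lemma bind_PiM_kernels:
  assumes P: "\<And>i. P i \<in> space (prob_algebra (M i))"
    and K: "\<And>i. K i \<in> M i \<rightarrow>\<^sub>M prob_algebra (Z i)" and "finite I"
  shows "PiM I P \<bind> (\<lambda>x. PiM I (\<lambda>i. K i (x i))) = PiM I (\<lambda>i. P i \<bind> K i)"
proof -
  interpret B: product_prob_space "\<lambda>i. P i \<bind> K i" I
    by (intro product_prob_spaceI prob_space_bind'[OF P K])
  interpret PP: product_prob_space P I
    using P by (intro product_prob_spaceI) (auto simp: space_prob_algebra)
  have setsP: "sets (P i) = sets (M i)" for i using P by (auto simp: space_prob_algebra)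
  have PiP: "PiM I P \<in> space (prob_algebra (PiM I M))"
    using PP.prob_space_axioms by (auto simp: space_prob_algebra setsP intro!: sets_PiM_cong)
  note kernels = measurable_PiM_kernels[OF K \<open>finite I\<close>]
  have sets_bindi: "sets (P i \<bind> K i) = sets (Z i)" for i by (rule sets_bind'[OF P K])
  show ?thesis
  proof (rule B.PiM_eqI[OF \<open>finite I\<close>])
    show "sets (PiM I P \<bind> (\<lambda>x. PiM I (\<lambda>i. K i (x i)))) = sets (PiM I (\<lambda>i. P i \<bind> K i))"
      unfolding sets_bind'[OF PiP kernels] by (intro sets_PiM_cong) (auto simp: sets_bindi)
    fix A assume "\<And>i. i \<in> I \<Longrightarrow> A i \<in> sets (P i \<bind> K i)"
    then have A: "\<And>i. i \<in> I \<Longrightarrow> A i \<in> sets (Z i)" by (simp add: sets_bindi)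
    have "emeasure (PiM I P \<bind> (\<lambda>x. PiM I (\<lambda>i. K i (x i)))) (Pi\<^sub>E I A) =
        (\<integral>\<^sup>+x. emeasure (PiM I (\<lambda>i. K i (x i))) (Pi\<^sub>E I A) \<partial>PiM I P)"
      using A \<open>finite I\<close> by (intro emeasure_bind_prob_algebra[OF PiP kernels] sets_PiM_I_finite)
    also have "\<dots> = (\<integral>\<^sup>+x. (\<Prod>i\<in>I. emeasure (K i (x i)) (A i)) \<partial>PiM I P)"
    proof (rule nn_integral_cong)
      fix x assume "x \<in> space (PiM I P)"
      then have Kx: "K i (x i) \<in> space (prob_algebra (Z i))" if "i \<in> I" for i
        using K[of i] that sets_eq_imp_space_eq[OF setsP]
        by (auto simp: space_PiM intro: measurable_space)
      then show "emeasure (PiM I (\<lambda>i. K i (x i))) (Pi\<^sub>E I A) = (\<Prod>i\<in>I. emeasure (K i (x i)) (A i))"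
        using \<open>finite I\<close> A by (intro emeasure_PiM_box) (auto simp: space_prob_algebra)
    qed
    also have "\<dots> = (\<Prod>i\<in>I. \<integral>\<^sup>+y. emeasure (K i y) (A i) \<partial>P i)"
    proof (rule PP.product_nn_integral_prod[OF \<open>finite I\<close>])
      fix i assume i: "i \<in> I"
      have "(\<lambda>y. emeasure (K i y) (A i)) \<in> borel_measurable (M i)"
        using measurable_compose[OF measurable_prob_algebraD[OF K] measurable_emeasure_subprob_algebra[OF A[OF i]]] .
      then show "(\<lambda>y. emeasure (K i y) (A i)) \<in> borel_measurable (P i)"
        using measurable_cong_sets[OF setsP refl] by blast
    qed
    also have "\<dots> = (\<Prod>i\<in>I. emeasure (P i \<bind> K i) (A i))"
      using A by (intro prod.cong refl emeasure_bind_prob_algebra[OF P K, symmetric]) auto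
    finally show "emeasure (PiM I P \<bind> (\<lambda>x. PiM I (\<lambda>i. K i (x i)))) (Pi\<^sub>E I A) =
        (\<Prod>i\<in>I. emeasure (P i \<bind> K i) (A i))" .
  qed
qed

text \<open>Only \<open>Q i\<close> with \<open>i < n\<close> is known to be a kernel; replacing the others by \<open>Q 0\<close> gives a
  family of probability spaces indexed by all of \<open>nat\<close>, as product spaces require.\<close>

abbreviation user :: "nat \<Rightarrow> nat \<Rightarrow> nat" where
  "user n i \<equiv> (if i < n then i else 0)"

lemma private_law_eq_PiM:
  assumes Q: "\<forall>i<n. Q i \<in> RV d \<rightarrow>\<^sub>M prob_algebra (RV d)" and "1 \<le> n"
    and P: "P \<in> space (prob_algebra (RV d))"
  shows "private_law n Q P = (\<Pi>\<^sub>M i\<in>{..<n}. P \<bind> Q (user n i))"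
proof -
  have "private_law n Q P = (\<Pi>\<^sub>M i\<in>{..<n}. P) \<bind> (\<lambda>x. \<Pi>\<^sub>M i\<in>{..<n}. Q (user n i) (x i))"
    unfolding private_law_def by (intro arg_cong2[of _ _ _ _ bind] refl ext PiM_cong) auto
  also have "\<dots> = (\<Pi>\<^sub>M i\<in>{..<n}. P \<bind> Q (user n i))"
    using Q \<open>1 \<le> n\<close> P by (intro bind_PiM_kernels[where M="\<lambda>_. RV d" and Z="\<lambda>_. RV d"]) auto
  finally show ?thesis .
qed

lemma user_law_prob:
  assumes Q: "\<forall>i<n. Q i \<in> RV d \<rightarrow>\<^sub>M prob_algebra (RV d)" and "1 \<le> n"
    and P: "P \<in> space (prob_algebra (RV d))"
  shows "prob_space (P \<bind> Q (user n i))" "sets (P \<bind> Q (user n i)) = sets (RV d)"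
  using assms by (auto intro!: prob_space_bind'[OF P] sets_bind'[OF P])

lemma sets_private_law:
  assumes "\<forall>i<n. Q i \<in> RV d \<rightarrow>\<^sub>M prob_algebra (RV d)" "1 \<le> n"
    and "P \<in> space (prob_algebra (RV d))"
  shows "sets (private_law n Q P) = sets (RVs n d)"
  by (subst private_law_eq_PiM) (use assms in \<open>auto intro!: sets_PiM_cong simp: sets_bind'[OF assms(3), where N="RV d"]\<close>)

lemma selector_component_measurable:
  assumes "h \<in> selectors d n" "j < d"
  shows "(\<lambda>z. h z j) \<in> RVs n d \<rightarrow>\<^sub>M count_space {0, 1}"
  using measurable_compose[OF _ measurable_component_singleton[of j "{..<d}"]] assms
  unfolding selectors_def by blast

lemma (in noise) risk_eq_sum:
  assumes Q: "\<forall>i<n. Q i \<in> RV d \<rightarrow>\<^sub>M prob_algebra (RV d)" and "1 \<le> n" and h: "h \<in> selectors d n"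
  shows "risk \<nu> \<sigma> d n Q h \<theta> = (\<Sum>j<d. emeasure (private_law n Q (obs_law \<nu> \<sigma> d \<theta>))
    {z \<in> space (RVs n d). h z j \<noteq> support_vec d \<theta> j})"
proof -
  let ?\<mu> = "private_law n Q (obs_law \<nu> \<sigma> d \<theta>)"
  have s: "sets ?\<mu> = sets (RVs n d)"
    by (intro sets_private_law Q \<open>1 \<le> n\<close> obs_law_in_prob_algebra)
  let ?E = "\<lambda>j. {z \<in> space (RVs n d). h z j \<noteq> support_vec d \<theta> j}"
  have E: "?E j \<in> sets ?\<mu>" if "j < d" for j
  proof -
    have "?E j = (\<lambda>z. h z j) -` ({0, 1} - {support_vec d \<theta> j}) \<inter> space (RVs n d)"
      using measurable_space[OF selector_component_measurable[OF h that]] by auto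
    also have "\<dots> \<in> sets (RVs n d)"
      by (rule measurable_sets[OF selector_component_measurable[OF h that]]) auto
    finally show ?thesis unfolding s .
  qed
  have "risk \<nu> \<sigma> d n Q h \<theta> = (\<integral>\<^sup>+z. (\<Sum>j<d. indicator (?E j) z) \<partial>?\<mu>)"
    unfolding risk_def
  proof (rule nn_integral_cong)
    fix z assume "z \<in> space ?\<mu>"
    then have "z \<in> space (RVs n d)" using sets_eq_imp_space_eq[OF s] by auto
    then show "(of_nat (hamming d (h z) (support_vec d \<theta>)) :: ennreal) = (\<Sum>j<d. indicator (?E j) z)"
      unfolding hamming_def by (auto simp: indicator_def intro!: sum.cong)
  qed
  also have "\<dots> = (\<Sum>j<d. \<integral>\<^sup>+z. indicator (?E j) z \<partial>?\<mu>)"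
    using E by (intro nn_integral_sum) auto
  also have "\<dots> = (\<Sum>j<d. emeasure ?\<mu> (?E j))"
    using E by (intro sum.cong) auto
  finally show ?thesis .
qed

section \<open>Lower bound\<close>

lemma ldp_mechanismsD:
  assumes "Q \<in> ldp_mechanisms d n \<alpha>" "i < n"
  shows "Q i \<in> RV d \<rightarrow>\<^sub>M prob_algebra (RV d)"
    and "A \<in> sets (RV d) \<Longrightarrow> x \<in> space (RV d) \<Longrightarrow> x' \<in> space (RV d) \<Longrightarrow>
      measure (Q i x) A \<le> exp \<alpha> * measure (Q i x') A"
  using assms by (auto simp: ldp_mechanisms_def)

lemma zero_vec_in_Theta: "zero_vec d \<in> Theta_plus d s a"
  unfolding Theta_plus_def by (auto simp: zero_vec_def intro!: exI[of _ "{}"])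

lemma spike_in_Theta: "j < d \<Longrightarrow> 1 \<le> s \<Longrightarrow> spike d a j \<in> Theta_plus d s a"
  unfolding Theta_plus_def by (auto simp: spike_def intro!: exI[of _ "{j}"])

text \<open>The tangent of exp(-x) at x = ln d, where the value is 1 / d.\<close>

lemma exp_uminus_ge_tangent:
  fixes x d :: real
  assumes "0 < d"
  shows "(1 - x + ln d) / d \<le> exp (- x)"
proof -
  have "1 + (ln d - x) \<le> exp (ln d - x)" by (rule exp_ge_add_one_self)
  also have "\<dots> = d * exp (- x)" using assms by (simp add: exp_diff exp_minus field_simps)
  finally show ?thesis using assms by (simp add: field_simps)
qed

context noise
begin

text \<open>An indicator equals its square, so the second-moment comparison becomes one of
  probabilities. \<open>B j\<close> adds up the divergences of all users, the product of the
  \<open>1 + D i j\<close> being at most the exponential of the sum. \<open>B\<close> is fixed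
  before the event, so each coordinate may later use its own.\<close>

lemma event_probability_bound:
  assumes Q: "Q \<in> ldp_mechanisms d n \<alpha>" and "0 < t" "1 \<le> n"
  shows "\<exists>B. (\<Sum>j<d. B j) \<le> real n * ((sinh \<alpha>)\<^sup>2 * (exp (c_plus * t\<^sup>2) - 1)) \<and>
    (\<forall>j<d. \<forall>A\<in>sets (RVs n d).
      (measure (private_law n Q (obs_law \<nu> \<sigma> d (spike d (\<sigma> * t) j))) A)\<^sup>2 \<le>
      exp (B j) * measure (private_law n Q (obs_law \<nu> \<sigma> d (zero_vec d))) A)"
proof -
  have kernels: "\<forall>i<n. Q i \<in> RV d \<rightarrow>\<^sub>M prob_algebra (RV d)"
    using ldp_mechanismsD(1)[OF Q] by blast
  let ?P = "\<lambda>j. obs_law \<nu> \<sigma> d (spike d (\<sigma> * t) j)" and ?Z = "obs_law \<nu> \<sigma> d (zero_vec d)"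
  define good where "good i D \<longleftrightarrow> (\<forall>j<d. 0 \<le> D j) \<and> (\<Sum>j<d. D j) \<le> (sinh \<alpha>)\<^sup>2 * (exp (c_plus * t\<^sup>2) - 1) \<and>
    (\<forall>j<d. \<forall>F\<in>borel_measurable (RV d). (\<forall>z. 0 \<le> F z \<and> F z \<le> (1::real)) \<longrightarrow>
      (\<integral>z. F z \<partial>(?P j \<bind> Q i))\<^sup>2 \<le> (1 + D j) * (\<integral>z. (F z)\<^sup>2 \<partial>(?Z \<bind> Q i)))" for i and D :: "nat \<Rightarrow> real"
  have "\<exists>D. good i D" if "i < n" for i
    unfolding good_def using ldp_mechanismsD[OF Q that] assms(2) by (intro user_second_moments) auto
  then obtain D where D: "\<And>i. i < n \<Longrightarrow> good i (D i)" by metis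
  define B where "B j = (\<Sum>i<n. D i j)" for j
  have "(\<Sum>j<d. B j) = (\<Sum>i<n. \<Sum>j<d. D i j)"
    unfolding B_def by (rule sum.swap)
  also have "\<dots> \<le> (\<Sum>i<n. (sinh \<alpha>)\<^sup>2 * (exp (c_plus * t\<^sup>2) - 1))"
    using D unfolding good_def by (intro sum_mono) auto
  finally have sumB: "(\<Sum>j<d. B j) \<le> real n * ((sinh \<alpha>)\<^sup>2 * (exp (c_plus * t\<^sup>2) - 1))" by simp
  have "(measure (private_law n Q (?P j)) A)\<^sup>2 \<le> exp (B j) * measure (private_law n Q ?Z) A"
    if j: "j < d" and A: "A \<in> sets (RVs n d)" for j A
  proof -
    let ?M = "\<lambda>i. ?Z \<bind> Q (user n i)" and ?M' = "\<lambda>i. ?P j \<bind> Q (user n i)"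
    have prob: "prob_space (?M i)" "sets (?M i) = sets (RV d)" "prob_space (?M' i)" "sets (?M' i) = sets (RV d)" for i
      by (rule user_law_prob[OF kernels \<open>1 \<le> n\<close> obs_law_in_prob_algebra])+
    have eq: "private_law n Q (?P j) = PiM {..<n} ?M'" "private_law n Q ?Z = PiM {..<n} ?M"
      by (rule private_law_eq_PiM[OF kernels \<open>1 \<le> n\<close> obs_law_in_prob_algebra])+
    have sets: "sets (PiM {..<n} ?M) = sets (RVs n d)" "sets (PiM {..<n} ?M') = sets (RVs n d)"
      by (intro sets_PiM_cong refl prob)+
    have indicator: "indicat_real A \<in> borel_measurable (PiM {..<n} ?M)"
      by (intro borel_measurable_indicator) (use A in \<open>simp only: sets\<close>)
    have D0: "0 \<le> D i j" if "i < n" for i using D[OF that] j by (auto simp: good_def)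
    have "(\<integral>z. indicator A z \<partial>PiM {..<n} ?M')\<^sup>2 \<le>
        (\<Prod>i<n. 1 + D i j) * (\<integral>z. (indicator A z)\<^sup>2 \<partial>PiM {..<n} ?M)"
    proof (rule PiM_second_moment_bound)
      fix i and G :: "(nat \<Rightarrow> real) \<Rightarrow> real"
      assume i: "i \<in> {..<n}" and G: "G \<in> borel_measurable (?M i)" "\<And>x. 0 \<le> G x \<and> G x \<le> 1"
      have "G \<in> borel_measurable (RV d)"
        using G(1) measurable_cong_sets[OF prob(2) refl] by blast
      then show "(\<integral>x. G x \<partial>?M' i)\<^sup>2 \<le> (1 + D i j) * (\<integral>x. (G x)\<^sup>2 \<partial>?M i)"
        using D[of i] i j G(2) by (auto simp: good_def)
    qed (use prob indicator D0 in \<open>auto simp: add_nonneg_nonneg split: split_indicator\<close>)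
    moreover have "(\<lambda>z. (indicator A z)\<^sup>2) = (indicator A :: _ \<Rightarrow> real)"
      by (auto simp: indicator_def)
    ultimately have "(measure (PiM {..<n} ?M') A)\<^sup>2 \<le> (\<Prod>i<n. 1 + D i j) * measure (PiM {..<n} ?M) A"
      using A sets by (simp add: sets.sets_into_space Int_absorb2)
    also have "\<dots> \<le> exp (B j) * measure (PiM {..<n} ?M) A"
    proof (rule mult_right_mono)
      have "(\<Prod>i<n. 1 + D i j) \<le> (\<Prod>i<n. exp (D i j))"
        using D0 by (intro prod_mono) (auto intro: add_nonneg_nonneg)
      then show "(\<Prod>i<n. 1 + D i j) \<le> exp (B j)" by (simp add: B_def exp_sum)
    qed simp
    finally show ?thesis unfolding eq .
  qed
  then show ?thesis using sumB by blast
qed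

lemma minimax_lower_bound:
  assumes Q: "Q \<in> ldp_mechanisms d n \<alpha>" and hh: "hh \<in> selectors d n"
    and pos: "0 < \<sigma>" "0 < t" and "1 \<le> n" "1 \<le> d" "1 \<le> s"
    and budget: "real n * ((sinh \<alpha>)\<^sup>2 * (exp (c_plus * t\<^sup>2) - 1)) \<le> real d * ln (real d)"
  shows "ennreal (1 / 4) \<le> (SUP \<theta>\<in>Theta_plus d s (\<sigma> * t). risk \<nu> \<sigma> d n Q hh \<theta>)"
proof (rule ccontr)
  assume "\<not> ?thesis"
  then have small: "risk \<nu> \<sigma> d n Q hh \<theta> < ennreal (1 / 4)" if "\<theta> \<in> Theta_plus d s (\<sigma> * t)" for \<theta>
    using that by (meson SUP_upper le_less_trans not_le)
  have kernels: "\<forall>i<n. Q i \<in> RV d \<rightarrow>\<^sub>M prob_algebra (RV d)"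
    using ldp_mechanismsD(1)[OF Q] by blast
  let ?\<mu> = "\<lambda>j. private_law n Q (obs_law \<nu> \<sigma> d (spike d (\<sigma> * t) j))"
    and ?\<zeta> = "private_law n Q (obs_law \<nu> \<sigma> d (zero_vec d))"
  have prob: "prob_space (private_law n Q (obs_law \<nu> \<sigma> d \<theta>))" for \<theta>
    unfolding private_law_eq_PiM[OF kernels \<open>1 \<le> n\<close> obs_law_in_prob_algebra]
    by (intro prob_space_PiM user_law_prob[OF kernels \<open>1 \<le> n\<close> obs_law_in_prob_algebra])
  have sets: "sets (private_law n Q (obs_law \<nu> \<sigma> d \<theta>)) = sets (RVs n d)" for \<theta>
    by (intro sets_private_law kernels \<open>1 \<le> n\<close> obs_law_in_prob_algebra)
  define A where "A j = {z \<in> space (RVs n d). hh z j \<noteq> 0}" for j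
  have Aeq: "A j = (\<lambda>z. hh z j) -` {1} \<inter> space (RVs n d)" if "j < d" for j
    unfolding A_def using measurable_space[OF selector_component_measurable[OF hh that]] by fastforce
  have A: "A j \<in> sets (RVs n d)" if "j < d" for j
    unfolding Aeq[OF that] by (rule measurable_sets[OF selector_component_measurable[OF hh that]]) auto
  obtain B where B: "(\<Sum>j<d. B j) \<le> real n * ((sinh \<alpha>)\<^sup>2 * (exp (c_plus * t\<^sup>2) - 1))"
      "\<And>j. j < d \<Longrightarrow> (measure (?\<mu> j) (A j))\<^sup>2 \<le> exp (B j) * measure ?\<zeta> (A j)"
    using event_probability_bound[OF Q pos(2) \<open>1 \<le> n\<close>, of \<sigma>] A by blast
  have false_alarms: "(\<Sum>j<d. measure ?\<zeta> (A j)) \<le> 1 / 4"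
  proof -
    interpret prob_space ?\<zeta> by (rule prob)
    have "risk \<nu> \<sigma> d n Q hh (zero_vec d) = (\<Sum>j<d. emeasure ?\<zeta> (A j))"
      using kernels \<open>1 \<le> n\<close> hh
      by (subst risk_eq_sum) (auto simp: A_def support_vec_def zero_vec_def intro!: sum.cong)
    also have "\<dots> = ennreal (\<Sum>j<d. measure ?\<zeta> (A j))"
      by (simp add: emeasure_eq_measure)
    finally show ?thesis
      using small[OF zero_vec_in_Theta] by (simp add: ennreal_less_iff sum_nonneg)
  qed
  have "9 / 16 * exp (- B j) \<le> measure ?\<zeta> (A j)" if j: "j < d" for j
  proof -
    interpret prob_space "?\<mu> j" by (rule prob)
    have supp: "support_vec d (spike d (\<sigma> * t) j) j = 1"
      using j pos by (simp add: support_vec_def spike_def)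
    have "{z \<in> space (RVs n d). hh z j \<noteq> support_vec d (spike d (\<sigma> * t) j) j} = space (?\<mu> j) - A j"
      unfolding sets_eq_imp_space_eq[OF sets] Aeq[OF j] supp by auto
    \<comment> \<open>Of the risk at the spike only the miss at coordinate \<open>j\<close> is
      kept.\<close>
    then have "emeasure (?\<mu> j) (space (?\<mu> j) - A j) \<le> risk \<nu> \<sigma> d n Q hh (spike d (\<sigma> * t) j)"
      using kernels \<open>1 \<le> n\<close> hh j
      by (subst risk_eq_sum)
        (auto intro!: member_le_sum[of j "{..<d}" "\<lambda>k. emeasure (?\<mu> j) {z \<in> space (RVs n d). hh z k \<noteq> support_vec d (spike d (\<sigma> * t) j) k}", THEN order_trans[rotated]])
    also have "\<dots> < ennreal (1 / 4)"
      using j \<open>1 \<le> s\<close> by (intro small spike_in_Theta)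
    finally have "measure (?\<mu> j) (space (?\<mu> j) - A j) < 1 / 4"
      by (simp add: emeasure_eq_measure ennreal_less_iff)
    then have "3 / 4 \<le> measure (?\<mu> j) (A j)"
      using prob_compl[of "A j"] A[OF j] sets by simp
    \<comment> \<open>A detection probability of at least 3/4 enters squared, whence 9/16. Against
      false alarms totalling at most 1/4, this leaves at most 4/9 for the sum of the
      \<open>exp (- B j)\<close>.\<close>
    then have "(3 / 4)\<^sup>2 \<le> exp (B j) * measure ?\<zeta> (A j)"
      using B(2)[OF j] power_mono[of "3 / 4" "measure (?\<mu> j) (A j)" 2] by linarith
    then have "9 / 16 * exp (- B j) \<le> (exp (B j) * measure ?\<zeta> (A j)) * exp (- B j)"
      by (intro mult_right_mono) (auto simp: power2_eq_square)
    also have "\<dots> = measure ?\<zeta> (A j)" by (simp add: exp_minus)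
    finally show ?thesis .
  qed
  then have "(\<Sum>j<d. 9 / 16 * exp (- B j)) \<le> (\<Sum>j<d. measure ?\<zeta> (A j))"
    by (intro sum_mono) auto
  also note false_alarms
  finally have "(\<Sum>j<d. exp (- B j)) \<le> 4 / 9"
    unfolding sum_distrib_left[symmetric] by simp
  \<comment> \<open>Only the average of the \<open>B j\<close> is controlled, by ln d. Spreading it
    evenly makes each term 1 / d; the tangent at ln d shows that no uneven allocation gives a
    smaller sum.\<close>
  moreover have "1 \<le> (\<Sum>j<d. exp (- B j))"
  proof -
    have "(\<Sum>j<d. B j) \<le> real d * ln (real d)" using B(1) budget by simp
    then have "1 \<le> (real d - (\<Sum>j<d. B j) + real d * ln (real d)) / real d"
      using \<open>1 \<le> d\<close> by (simp add: field_simps)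
    also have "\<dots> = (\<Sum>j<d. (1 - B j + ln (real d)) / real d)"
      by (simp add: sum.distrib sum_subtractf flip: sum_divide_distrib)
    also have "\<dots> \<le> (\<Sum>j<d. exp (- B j))"
      using \<open>1 \<le> d\<close> by (intro sum_mono exp_uminus_ge_tangent) auto
    finally show ?thesis .
  qed
  ultimately show False by linarith
qed

end

text \<open>On (0,1], sinh x is at most x + x^2 / 2, hence at most 3/2 x.\<close>

lemma sinh_square_le:
  fixes x :: real
  assumes "0 < x" "x \<le> 1"
  shows "(sinh x)\<^sup>2 \<le> 9 / 4 * x\<^sup>2"
proof -
  have "exp x \<le> 1 + x + x\<^sup>2" using assms by (intro exp_bound) auto
  moreover have "1 - x \<le> exp (- x)" using exp_ge_add_one_self[of "- x"] by simp
  moreover have "x\<^sup>2 \<le> x" using assms by (simp add: power2_eq_square mult_left_le)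
  ultimately have "sinh x \<le> 3 / 2 * x" by (simp add: sinh_field_def)
  then have "(sinh x)\<^sup>2 \<le> (3 / 2 * x)\<^sup>2"
    using assms by (intro power_mono) auto
  then show ?thesis by (simp add: power_mult_distrib power_divide)
qed

context noise
begin

lemma L_const_ge: "c_plus \<le> L_const c_plus"
proof -
  have "x / 2 \<le> (y - 1) / 2" if "1 + x \<le> y" for x y :: real using that by simp
  from this[OF exp_ge_add_one_self[of "2 * c_plus"]] show ?thesis by (simp add: L_const_def)
qed

text \<open>The constant 16 leaves ample room: one user contributes at most 9/4 * 1/64 times
  \<alpha>^2 u, where \<alpha>^2 u would do.\<close>

lemma information_budget:
  assumes \<alpha>: "0 < \<alpha>" "\<alpha> \<le> 1" and "0 < n" "1 < d"
    and signal: "ln d \<le> n * \<alpha>\<^sup>2 / d"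
    and t: "0 < t" "t \<le> 1 / (16 * L_const c_plus) * sqrt (d * ln d / (n * \<alpha>\<^sup>2))"
  shows "n * ((sinh \<alpha>)\<^sup>2 * (exp (c_plus * t\<^sup>2) - 1)) \<le> d * ln d"
proof -
  define u where "u = d * ln d / (n * \<alpha>\<^sup>2)"
  \<comment> \<open>\<open>u \<le> 1\<close> is \<open>signal\<close> rearranged; it keeps the
    exponent in the range of the quadratic bound on exp.\<close>
  have u: "0 < u" "u \<le> 1"
    using assms by (auto simp: u_def field_simps)
  have c: "1 / 2 \<le> c_plus" "c_plus \<le> L_const c_plus" by (rule c_plus_ge_half L_const_ge)+
  have "t\<^sup>2 \<le> (1 / (16 * L_const c_plus) * sqrt u)\<^sup>2"
    using t unfolding u_def by (intro power_mono) auto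
  also have "\<dots> = u / (256 * (L_const c_plus)\<^sup>2)"
    using u by (simp add: power_mult_distrib power_divide)
  finally have "c_plus * t\<^sup>2 \<le> c_plus * (u / (256 * (L_const c_plus)\<^sup>2))"
    using c by (intro mult_left_mono) auto
  \<comment> \<open>Here c_plus \<ge> 1/2 gives c_plus \<le> 2 c_plus^2 \<le> 2 L^2, and 2 / 256 = 1
    / 128.\<close>
  also have "\<dots> \<le> u / 128"
  proof -
    have "c_plus * 1 \<le> c_plus * (2 * c_plus)" using c by (intro mult_left_mono) auto
    also have "\<dots> \<le> 2 * (L_const c_plus)\<^sup>2"
      using c power_mono[of c_plus "L_const c_plus" 2] by (simp add: power2_eq_square)
    finally have "c_plus * u \<le> 2 * (L_const c_plus)\<^sup>2 * u" using u by (intro mult_right_mono) auto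
    then show ?thesis using c by (simp add: field_simps)
  qed
  finally have y: "c_plus * t\<^sup>2 \<le> u / 128" .
  have y0: "0 \<le> c_plus * t\<^sup>2" using c by simp
  have "exp (c_plus * t\<^sup>2) \<le> 1 + c_plus * t\<^sup>2 + (c_plus * t\<^sup>2)\<^sup>2"
    using y y0 u by (intro exp_bound) auto
  also have "(c_plus * t\<^sup>2)\<^sup>2 \<le> c_plus * t\<^sup>2"
    using y y0 u by (simp add: power2_eq_square[of "c_plus * t\<^sup>2"] mult_left_le)
  finally have e: "exp (c_plus * t\<^sup>2) - 1 \<le> u / 64" using y by simp
  have "(sinh \<alpha>)\<^sup>2 * (exp (c_plus * t\<^sup>2) - 1) \<le> (9 / 4 * \<alpha>\<^sup>2) * (u / 64)"
    using e sinh_square_le[OF \<alpha>] y0 by (intro mult_mono) auto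
  also have "\<dots> \<le> \<alpha>\<^sup>2 * u" using u by simp
  finally have "n * ((sinh \<alpha>)\<^sup>2 * (exp (c_plus * t\<^sup>2) - 1)) \<le> n * (\<alpha>\<^sup>2 * u)"
    using \<open>0 < n\<close> by (intro mult_left_mono) auto
  also have "\<dots> = d * ln d"
    using assms by (simp add: u_def)
  finally show ?thesis .
qed

lemma exact_recovery_impossible_below_a_star:
  fixes \<alpha> :: "nat \<Rightarrow> real"
  assumes "0 < \<sigma>" and n: "\<forall>d\<ge>1. 1 \<le> n d" and s: "\<forall>d\<ge>1. 1 \<le> s d"
    and \<alpha>: "\<forall>d\<ge>1. 0 < \<alpha> d \<and> \<alpha> d \<le> 1"
    and signal: "dominates (\<lambda>d. real (n d) * (\<alpha> d)\<^sup>2 / real d) (\<lambda>d. ln (real d))"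
    and a: "\<forall>\<^sub>F d in sequentially. 0 < a d \<and> a d \<le> a_star \<sigma> c_plus n \<alpha> d"
  shows "exact_recovery_impossible \<nu> \<sigma> n s \<alpha> a"
proof -
  have "\<forall>\<^sub>F d in sequentially. 1 \<le> (real (n d) * (\<alpha> d)\<^sup>2 / real d) / ln (real d)"
    using signal unfolding dominates_def filterlim_at_top by blast
  then have "\<forall>\<^sub>F d in sequentially. ennreal (1 / 4) \<le>
      (INF Q\<in>ldp_mechanisms d (n d) (\<alpha> d). INF h\<in>separable_selectors d (n d).
        SUP \<theta>\<in>Theta_plus d (s d) (a d). risk \<nu> \<sigma> d (n d) Q h \<theta>)"
    \<comment> \<open>From d = 2 on ln d is positive, so the quotient by ln d can be
      cleared.\<close>
    using a eventually_ge_at_top[of 2]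
  proof eventually_elim
    case (elim d)
    then have d: "1 \<le> d" "1 < real d" "0 < ln (real d)" by auto
    define t where "t = a d / \<sigma>"
    have t: "0 < t" "a d = \<sigma> * t" using elim \<open>0 < \<sigma>\<close> by (auto simp: t_def)
    have "t \<le> 1 / (16 * L_const c_plus) * sqrt (real d * ln (real d) / (real (n d) * (\<alpha> d)\<^sup>2))"
      using elim \<open>0 < \<sigma>\<close> unfolding t_def a_star_def by (simp add: field_simps)
    moreover have "ln (real d) \<le> real (n d) * (\<alpha> d)\<^sup>2 / real d"
      using elim(1) d by (simp add: pos_le_divide_eq mult.commute)
    ultimately have budget: "real (n d) * ((sinh (\<alpha> d))\<^sup>2 * (exp (c_plus * t\<^sup>2) - 1)) \<le> real d * ln (real d)"
      using \<alpha> n d t by (intro information_budget) (auto simp: Suc_le_eq)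
    show ?case
      using \<alpha> n s d t budget \<open>0 < \<sigma>\<close> unfolding t(2)
      by (intro INF_greatest minimax_lower_bound) (auto simp: separable_selectors_def)
  qed
  then have "ennreal (1 / 4) \<le> liminf (\<lambda>d. INF Q\<in>ldp_mechanisms d (n d) (\<alpha> d).
      INF h\<in>separable_selectors d (n d). SUP \<theta>\<in>Theta_plus d (s d) (a d). risk \<nu> \<sigma> d (n d) Q h \<theta>)"
    by (rule Liminf_bounded)
  moreover have "(0::ennreal) < ennreal (1 / 4)" by simp
  ultimately show ?thesis
    unfolding exact_recovery_impossible_def by (rule less_le_trans[rotated])
qed

end

section \<open>Randomized response: privacy and moment generating function of a vote\<close>

lemma exp_le_quadratic:
  fixes y :: real
  assumes "\<bar>y\<bar> \<le> 1"
  shows "exp y \<le> 1 + y + y\<^sup>2"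
proof (cases "0 \<le> y")
  case True
  then show ?thesis using assms by (intro exp_bound) auto
next
  case False
  define x where "x = - y"
  have x: "0 < x" "x \<le> 1" using False assms by (auto simp: x_def)
  have "1 + x \<le> exp x" by (rule exp_ge_add_one_self)
  have "exp y = 1 / exp x" by (simp add: x_def exp_minus field_simps)
  also have "\<dots> \<le> 1 / (1 + x)" using x \<open>1 + x \<le> exp x\<close> by (intro divide_left_mono) auto
  also have "\<dots> \<le> 1 - x + x\<^sup>2"
  proof -
    have "(1 - x + x\<^sup>2) * (1 + x) = 1 + x ^ 3" by (simp add: algebra_simps power2_eq_square power3_eq_cube)
    then show ?thesis using x by (simp add: pos_divide_le_eq)
  qed
  finally show ?thesis by (simp add: x_def)
qed

text \<open>Moment generating function of a random sign with mean 2 q - 1. The coefficient 1 of l^2,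
  cruder than the 1/2 of Hoeffding, affects only constants.\<close>

lemma biased_sign_mgf_le:
  fixes l q :: real
  assumes "0 \<le> q" "q \<le> 1" "\<bar>l\<bar> \<le> 1"
  shows "q * exp l + (1 - q) * exp (- l) \<le> exp (l * (2 * q - 1) + l\<^sup>2)"
proof -
  have "q * exp l + (1 - q) * exp (- l) \<le> q * (1 + l + l\<^sup>2) + (1 - q) * (1 + (- l) + (- l)\<^sup>2)"
    using assms by (intro add_mono mult_left_mono exp_le_quadratic) auto
  also have "\<dots> = 1 + (l * (2 * q - 1) + l\<^sup>2)" by (simp add: algebra_simps)
  also have "\<dots> \<le> exp (l * (2 * q - 1) + l\<^sup>2)" by (rule exp_ge_add_one_self)
  finally show ?thesis .
qed

definition sign_vote :: "nat \<Rightarrow> real \<Rightarrow> (nat \<Rightarrow> real) measure" where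
  "sign_vote d q = distr (measure_pmf (bernoulli_pmf q)) (RV d) (\<lambda>b. \<lambda>k\<in>{..<d}. if b then 1 else - 1)"

text \<open>Each user reports one random sign, biased by the sign of a single coordinate; it is broadcast
  to all output coordinates only because outputs live in \<open>\<real>\<^sup>d\<close>.\<close>

definition randomized_response :: "nat \<Rightarrow> real \<Rightarrow> nat \<Rightarrow> (nat \<Rightarrow> real) \<Rightarrow> (nat \<Rightarrow> real) measure" where
  "randomized_response d \<alpha> j x = (if 0 < x j then sign_vote d (1 / 2 + \<alpha> / 8) else sign_vote d (1 / 2 - \<alpha> / 8))"

lemma sign_vector_measurable: "(\<lambda>b. \<lambda>k\<in>{..<d}. if b then 1 else - 1) \<in> measure_pmf p \<rightarrow>\<^sub>M RV d"
  by (simp add: measurable_def space_PiM)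

lemma sign_vote_in_prob_algebra: "sign_vote d q \<in> space (prob_algebra (RV d))"
  unfolding sign_vote_def space_prob_algebra
  using measure_pmf.prob_space_distr[OF sign_vector_measurable] by simp

lemma randomized_response_measurable:
  assumes "j < d"
  shows "randomized_response d \<alpha> j \<in> RV d \<rightarrow>\<^sub>M prob_algebra (RV d)"
  unfolding randomized_response_def
proof (rule measurable_If)
  have "(\<lambda>x. x j) \<in> borel_measurable (RV d)"
    using assms by (intro measurable_component_singleton) auto
  then show "{x \<in> space (RV d). 0 < x j} \<in> sets (RV d)" by measurable
qed (auto intro!: measurable_const sign_vote_in_prob_algebra)

text \<open>Everything reduces to the two outcomes of a coin. The worst ratio of their probabilities
  is (1/2 + \<alpha>/8) / (1/2 - \<alpha>/8), which is at most 1 + \<alpha> for \<alpha> \<le>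
  1.\<close>

lemma measure_sign_vote_le:
  assumes q: "1 / 2 - \<alpha> / 8 \<le> q" "q \<le> 1 / 2 + \<alpha> / 8" and q': "1 / 2 - \<alpha> / 8 \<le> q'" "q' \<le> 1 / 2 + \<alpha> / 8"
    and \<alpha>: "0 < \<alpha>" "\<alpha> \<le> 1" and A: "A \<in> sets (RV d)"
  shows "measure (sign_vote d q) A \<le> exp \<alpha> * measure (sign_vote d q') A"
proof -
  have key: "1 / 2 + \<alpha> / 8 \<le> exp \<alpha> * (1 / 2 - \<alpha> / 8)"
  proof -
    have "\<alpha> * \<alpha> \<le> \<alpha> * 1" using \<alpha> by (intro mult_left_mono) auto
    moreover have "(1 + \<alpha>) * (1 / 2 - \<alpha> / 8) = 1 / 2 + 3 / 8 * \<alpha> - \<alpha> * \<alpha> / 8" by (simp add: field_simps)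
    ultimately have "1 / 2 + \<alpha> / 8 \<le> (1 + \<alpha>) * (1 / 2 - \<alpha> / 8)" using \<alpha> by simp
    also have "\<dots> \<le> exp \<alpha> * (1 / 2 - \<alpha> / 8)"
      using \<alpha> by (intro mult_right_mono exp_ge_add_one_self) auto
    finally show ?thesis .
  qed
  have "r \<le> exp \<alpha> * r'" if "r \<le> 1 / 2 + \<alpha> / 8" "1 / 2 - \<alpha> / 8 \<le> r'" for r r'
  proof -
    have "exp \<alpha> * (1 / 2 - \<alpha> / 8) \<le> exp \<alpha> * r'" using that by (intro mult_left_mono) auto
    then show ?thesis using key that by linarith
  qed
  from this[of q q'] this[of "1 - q" "1 - q'"]
  have "pmf (bernoulli_pmf q) b \<le> exp \<alpha> * pmf (bernoulli_pmf q') b" for b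
    using q q' \<alpha> by (cases b) auto
  then have "measure (bernoulli_pmf q) B \<le> exp \<alpha> * measure (bernoulli_pmf q') B" for B
    by (simp add: measure_measure_pmf_finite sum_distrib_left sum_mono)
  then show ?thesis
    unfolding sign_vote_def measure_distr[OF sign_vector_measurable A] by simp
qed

lemma randomized_response_ldp:
  assumes "0 < \<alpha>" "\<alpha> \<le> 1" "1 \<le> d"
  shows "(\<lambda>i. randomized_response d \<alpha> (i mod d)) \<in> ldp_mechanisms d n \<alpha>"
  unfolding ldp_mechanisms_def using assms
  by (auto intro!: randomized_response_measurable measure_sign_vote_le simp: randomized_response_def)

lemma nn_integral_sign_vote:
  assumes "0 \<le> q" "q \<le> 1" "j < d"
  shows "(\<integral>\<^sup>+z. ennreal (exp (l * z j)) \<partial>sign_vote d q) = ennreal (q * exp l + (1 - q) * exp (- l))"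
proof -
  have m: "(\<lambda>z. z j) \<in> borel_measurable (RV d)"
    using assms by (intro measurable_component_singleton) auto
  have "(\<integral>\<^sup>+z. ennreal (exp (l * z j)) \<partial>sign_vote d q) =
      (\<integral>\<^sup>+b. ennreal (exp (l * (if b then 1 else - 1))) \<partial>bernoulli_pmf q)"
    unfolding sign_vote_def using assms m
    by (subst nn_integral_distr[OF sign_vector_measurable]) auto
  also have "\<dots> = ennreal (q * exp l + (1 - q) * exp (- l))"
    using assms by (simp add: mult.commute ennreal_plus flip: ennreal_mult)
  finally show ?thesis .
qed

context noise
begin

text \<open>Mean of a vote when the signal is \<open>u\<close> noise standard deviations: the coin
  has mean plus or minus \<alpha> / 4, and the sign it follows has mean
  \<open>measure \<nu> {-u<..<u}\<close> by \<open>tail_difference\<close>. It vanishes at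
  \<open>u = 0\<close>.\<close>

definition vote_bias :: "real \<Rightarrow> real \<Rightarrow> real" where
  "vote_bias \<alpha> u = \<alpha> / 4 * measure \<nu> {-u<..<u}"

lemma vote_mgf_le:
  assumes "j < d" "\<bar>l\<bar> \<le> 1" and \<alpha>: "0 < \<alpha>" "\<alpha> \<le> 1" and "0 < \<sigma>" "0 \<le> \<theta> j"
  shows "(\<integral>\<^sup>+z. ennreal (exp (l * z j)) \<partial>(obs_law \<nu> \<sigma> d \<theta> \<bind> randomized_response d \<alpha> j)) \<le>
    ennreal (exp (l * vote_bias \<alpha> (\<theta> j / \<sigma>) + l\<^sup>2))"
proof -
  interpret prob_space \<nu> by (rule prob_\<nu>)
  define u where "u = \<theta> j / \<sigma>"
  have u: "0 \<le> u" "\<theta> j = \<sigma> * u" using assms by (auto simp: u_def)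
  define c where "c q = q * exp l + (1 - q) * exp (- l)" for q
  define f where "f x = (if - u < x then c (1 / 2 + \<alpha> / 8) else c (1 / 2 - \<alpha> / 8))" for x
  have c0: "0 \<le> c q" if "0 \<le> q" "q \<le> 1" for q using that by (simp add: c_def)
  have pos: "0 < \<theta> j + \<sigma> * x \<longleftrightarrow> - u < x" for x
  proof -
    have "\<theta> j + \<sigma> * x = \<sigma> * (u + x)" by (simp add: u(2) algebra_simps)
    then show ?thesis using \<open>0 < \<sigma>\<close> by (simp add: zero_less_mult_iff) linarith
  qed
  have f_eq: "f = (\<lambda>x. c (1 / 2 + \<alpha> / 8) * indicator {-u<..} x + c (1 / 2 - \<alpha> / 8) * indicator {..-u} x)"
    by (auto simp: f_def indicator_def fun_eq_iff)
  have [measurable]: "f \<in> borel_measurable borel" unfolding f_eq by measurable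
  have int: "integrable \<nu> f" unfolding f_eq by (auto simp: emeasure_eq_measure)
  have f0: "0 \<le> f x" for x unfolding f_def using c0 \<alpha> by auto
  have [measurable]: "(\<lambda>z. z j) \<in> borel_measurable (RV d)"
    using assms by (intro measurable_component_singleton) auto
  have zm: "(\<lambda>z. ennreal (exp (l * z j))) \<in> borel_measurable (RV d)"
    by measurable
  have km: "(\<lambda>x. \<integral>\<^sup>+z. ennreal (exp (l * z j)) \<partial>randomized_response d \<alpha> j x) \<in> borel_measurable (RV d)"
    using measurable_compose[OF measurable_prob_algebraD[OF randomized_response_measurable] nn_integral_measurable_subprob_algebra[OF zm]] assms by auto
  have "(\<integral>\<^sup>+z. ennreal (exp (l * z j)) \<partial>(obs_law \<nu> \<sigma> d \<theta> \<bind> randomized_response d \<alpha> j)) =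
      (\<integral>\<^sup>+x. \<integral>\<^sup>+z. ennreal (exp (l * z j)) \<partial>randomized_response d \<alpha> j x \<partial>obs_law \<nu> \<sigma> d \<theta>)"
    using measurable_prob_algebraD[OF randomized_response_measurable[OF \<open>j < d\<close>]] zm
    by (intro nn_integral_bind[where B="RV d"]) (auto simp: obs_law_def)
  also have "\<dots> = (\<integral>\<^sup>+\<xi>. ennreal (f (\<xi> j)) \<partial>noise_vec d)"
    unfolding nn_integral_obs_law[OF km] using assms
    by (intro nn_integral_cong) (auto simp: randomized_response_def nn_integral_sign_vote pos f_def c_def)
  also have "\<dots> = ennreal (\<integral>\<xi>. f (\<xi> j) \<partial>noise_vec d)"
    using noise_coordinate(1)[OF \<open>j < d\<close>, of f] int f0 by (intro nn_integral_eq_integral) auto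
  also have "(\<integral>\<xi>. f (\<xi> j) \<partial>noise_vec d) = (\<integral>x. f x \<partial>\<nu>)"
    using assms by (intro noise_coordinate(2)) auto
  also have "\<dots> = c (1 / 2 + \<alpha> / 8) * measure \<nu> {-u<..} + c (1 / 2 - \<alpha> / 8) * measure \<nu> {..-u}"
    unfolding f_eq by (simp add: emeasure_eq_measure)
  \<comment> \<open>\<open>c\<close> is affine in the coin parameter, so mixing two coins over the
    sign of the observation is the same as one coin with the averaged parameter.\<close>
  also have "\<dots> = c (1 / 2 + vote_bias \<alpha> u / 2)"
  proof -
    have total: "measure \<nu> {-u<..} + measure \<nu> {..-u} = 1"
      by (subst finite_measure_Union[symmetric]) (auto intro!: arg_cong[where f=prob] simp flip: prob_space)
    have halves: "measure \<nu> {-u<..} = (1 + measure \<nu> {-u<..<u}) / 2" "measure \<nu> {..-u} = (1 - measure \<nu> {-u<..<u}) / 2"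
      using tail_difference[OF u(1)] total by auto
    show ?thesis unfolding halves c_def vote_bias_def by (simp add: field_simps)
  qed
  also have "\<dots> \<le> exp (l * vote_bias \<alpha> u + l\<^sup>2)"
  proof -
    have "\<alpha> / 4 * prob {-u<..<u} \<le> 1 * 1"
      using \<alpha> by (intro mult_mono) auto
    then have "0 \<le> vote_bias \<alpha> u" "vote_bias \<alpha> u \<le> 1"
      unfolding vote_bias_def using \<alpha> by auto
    then show ?thesis
      using biased_sign_mgf_le[of "1 / 2 + vote_bias \<alpha> u / 2" l] assms by (simp add: c_def)
  qed
  finally show ?thesis unfolding u_def by (simp add: ennreal_leI)
qed

end

section \<open>Upper bound: thresholding the votes\<close>

definition group :: "nat \<Rightarrow> nat \<Rightarrow> nat \<Rightarrow> nat set" where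
  "group n d j = {i. i < n \<and> i mod d = j}"

definition votes :: "nat \<Rightarrow> nat \<Rightarrow> nat \<Rightarrow> (nat \<Rightarrow> nat \<Rightarrow> real) \<Rightarrow> real" where
  "votes n d j z = (\<Sum>i\<in>group n d j. z i j)"

text \<open>The threshold is half of card * \<mu>: the expected total is 0 without a signal and at
  least card * \<mu> with one, if \<mu> is a lower bound for the bias.\<close>

definition threshold_selector :: "nat \<Rightarrow> nat \<Rightarrow> real \<Rightarrow> (nat \<Rightarrow> nat \<Rightarrow> real) \<Rightarrow> nat \<Rightarrow> nat" where
  "threshold_selector n d \<mu> z =
     (\<lambda>j\<in>{..<d}. if votes n d j z > real (card (group n d j)) * \<mu> / 2 then 1 else 0)"

lemma prod_mono_ennreal:
  fixes f g :: "'i \<Rightarrow> ennreal"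
  shows "(\<And>i. i \<in> I \<Longrightarrow> f i \<le> g i) \<Longrightarrow> prod f I \<le> prod g I"
  by (induction I rule: infinite_finite_induct) (auto intro!: mult_mono)

lemma finite_group: "finite (group n d j)"
  by (simp add: group_def)

lemma card_group_ge:
  assumes "j < d"
  shows "n div d \<le> card (group n d j)"
proof -
  have "k * d + j < n" if "k < n div d" for k
  proof -
    have "k * d + j < Suc k * d" using assms by simp
    also have "\<dots> \<le> (n div d) * d" using that by (intro mult_le_mono1) simp
    also have "\<dots> \<le> n" by simp
    finally show ?thesis .
  qed
  then have "(\<lambda>k. k * d + j) ` {..<n div d} \<subseteq> group n d j"
    using assms by (auto simp: group_def)
  moreover have "inj_on (\<lambda>k. k * d + j) {..<n div d}"
    using assms by (intro inj_onI) simp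
  ultimately show ?thesis
    using card_inj_on_le[of _ "{..<n div d}" "group n d j"] finite_group by fastforce
qed

lemma coordinate_measurable:
  assumes "i < n" "j < d"
  shows "(\<lambda>z. z i j) \<in> borel_measurable (RVs n d)"
  using measurable_compose[OF measurable_component_singleton[of i "{..<n}" "\<lambda>_. RV d"]
      measurable_component_singleton[of j "{..<d}" "\<lambda>_. borel"]] assms by simp

lemma votes_measurable:
  assumes "j < d"
  shows "votes n d j \<in> borel_measurable (RVs n d)"
  unfolding votes_def using assms
  by (intro borel_measurable_sum coordinate_measurable) (auto simp: group_def)

lemma threshold_selector_in_selectors: "threshold_selector n d \<mu> \<in> selectors d n"
  unfolding selectors_def threshold_selector_def
proof (rule measurable_restrict, rule measurable_If)
  fix j assume "j \<in> {..<d}"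
  then have [measurable]: "votes n d j \<in> borel_measurable (RVs n d)" by (intro votes_measurable) simp
  show "{z \<in> space (RVs n d). votes n d j z > real (card (group n d j)) * \<mu> / 2} \<in> sets (RVs n d)"
    by measurable
qed auto

context noise
begin

abbreviation vote_law :: "real \<Rightarrow> nat \<Rightarrow> nat \<Rightarrow> real \<Rightarrow> (nat \<Rightarrow> real) \<Rightarrow> (nat \<Rightarrow> nat \<Rightarrow> real) measure" where
  "vote_law \<sigma> n d \<alpha> \<theta> \<equiv> private_law n (\<lambda>i. randomized_response d \<alpha> (i mod d)) (obs_law \<nu> \<sigma> d \<theta>)"

text \<open>The sign of \<open>l\<close> selects the tail, so one statement covers false alarms
  (\<open>l\<close> positive) and misses (\<open>l\<close> negative).\<close>

lemma votes_chernoff: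
  assumes j: "j < d" and l: "\<bar>l\<bar> \<le> 1" and \<alpha>: "0 < \<alpha>" "\<alpha> \<le> 1" and "0 < \<sigma>" "0 \<le> \<theta> j" "1 \<le> n"
  shows "emeasure (vote_law \<sigma> n d \<alpha> \<theta>) {z \<in> space (RVs n d). 0 \<le> l * (votes n d j z - \<tau>)} \<le>
    ennreal (exp (real (card (group n d j)) * (l * vote_bias \<alpha> (\<theta> j / \<sigma>) + l\<^sup>2) - l * \<tau>))"
proof -
  let ?Q = "\<lambda>i. randomized_response d \<alpha> (i mod d)"
  let ?M = "\<lambda>i. obs_law \<nu> \<sigma> d \<theta> \<bind> ?Q (user n i)"
  have kernels: "\<forall>i<n. ?Q i \<in> RV d \<rightarrow>\<^sub>M prob_algebra (RV d)"
    using j by (auto intro!: randomized_response_measurable)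
  note user = user_law_prob[OF kernels \<open>1 \<le> n\<close> obs_law_in_prob_algebra]
  interpret P: product_prob_space ?M "{..<n}"
    by (intro product_prob_spaceI user)
  have eq: "vote_law \<sigma> n d \<alpha> \<theta> = PiM {..<n} ?M"
    by (rule private_law_eq_PiM[OF kernels \<open>1 \<le> n\<close> obs_law_in_prob_algebra])
  have sets: "sets (PiM {..<n} ?M) = sets (RVs n d)"
    by (intro sets_PiM_cong refl user)
  define E where "E = {z \<in> space (RVs n d). 0 \<le> l * (votes n d j z - \<tau>)}"
  have [measurable]: "votes n d j \<in> borel_measurable (RVs n d)" by (rule votes_measurable[OF j])
  have E: "E \<in> sets (PiM {..<n} ?M)" unfolding sets E_def by measurable
  \<comment> \<open>Users outside the group get the factor 1, so that the integrand is a product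
    over all users and factors under the product law.\<close>
  define f where "f i x = (if i mod d = j then ennreal (exp (l * x j)) else 1)" for i :: nat and x :: "nat \<Rightarrow> real"
  define b where "b = l * vote_bias \<alpha> (\<theta> j / \<sigma>) + l\<^sup>2"
  have prod_split: "(\<Prod>i<n. if i mod d = j then g i else 1) = (\<Prod>i\<in>group n d j. g i)" for g :: "nat \<Rightarrow> ennreal"
    by (subst prod.inter_filter[symmetric]) (auto simp: group_def intro!: prod.cong)
  have fm: "f i \<in> borel_measurable (?M i)" for i
  proof -
    have [measurable]: "(\<lambda>x. x j) \<in> borel_measurable (RV d)"
      using j by (intro measurable_component_singleton) auto
    have "f i \<in> borel_measurable (RV d)" unfolding f_def by measurable
    then show ?thesis using measurable_cong_sets[OF user(2) refl] by blast
  qed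
  have "emeasure (PiM {..<n} ?M) E = (\<integral>\<^sup>+z. indicator E z \<partial>PiM {..<n} ?M)"
    using E by simp
  also have "\<dots> \<le> (\<integral>\<^sup>+z. ennreal (exp (- l * \<tau>)) * (\<Prod>i<n. f i (z i)) \<partial>PiM {..<n} ?M)"
  proof (rule nn_integral_mono)
    fix z
    have "(\<Prod>i<n. f i (z i)) = ennreal (exp (l * votes n d j z))"
      unfolding f_def prod_split
      by (simp add: votes_def sum_distrib_left exp_sum finite_group prod_ennreal)
    then have "ennreal (exp (- l * \<tau>)) * (\<Prod>i<n. f i (z i)) = ennreal (exp (l * (votes n d j z - \<tau>)))"
      by (simp add: right_diff_distrib exp_diff exp_minus field_simps flip: ennreal_mult)
    then show "indicator E z \<le> ennreal (exp (- l * \<tau>)) * (\<Prod>i<n. f i (z i))"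
      by (auto simp: E_def indicator_def)
  qed
  also have "\<dots> = ennreal (exp (- l * \<tau>)) * (\<integral>\<^sup>+z. (\<Prod>i<n. f i (z i)) \<partial>PiM {..<n} ?M)"
    by (intro nn_integral_cmult borel_measurable_prod_ennreal
        measurable_compose[OF measurable_component_singleton[where M="?M"] fm])
  also have "(\<integral>\<^sup>+z. (\<Prod>i<n. f i (z i)) \<partial>PiM {..<n} ?M) = (\<Prod>i<n. \<integral>\<^sup>+x. f i x \<partial>?M i)"
    by (intro P.product_nn_integral_prod fm) auto
  also have "\<dots> \<le> (\<Prod>i<n. if i mod d = j then ennreal (exp b) else 1)"
  proof (rule prod_mono_ennreal)
    fix i assume i: "i \<in> {..<n}"
    show "(\<integral>\<^sup>+x. f i x \<partial>?M i) \<le> (if i mod d = j then ennreal (exp b) else 1)"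
    proof (cases "i mod d = j")
      case True
      then have "(\<integral>\<^sup>+x. f i x \<partial>?M i) =
          (\<integral>\<^sup>+x. ennreal (exp (l * x j)) \<partial>(obs_law \<nu> \<sigma> d \<theta> \<bind> randomized_response d \<alpha> j))"
        using i by (simp add: f_def)
      also have "\<dots> \<le> ennreal (exp b)"
        unfolding b_def using assms by (intro vote_mgf_le)
      finally show ?thesis using True by simp
    next
      case False
      have "prob_space (?M i)" by (rule user(1))
      then show ?thesis
        using False prob_space.emeasure_space_1[of "?M i"] by (simp add: f_def del: if_split)
    qed
  qed
  also have "\<dots> = ennreal (exp (real (card (group n d j)) * b))"
    unfolding prod_split by (simp add: ennreal_power exp_of_nat_mult)
  also have "ennreal (exp (- l * \<tau>)) * ennreal (exp (real (card (group n d j)) * b)) =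
      ennreal (exp (real (card (group n d j)) * b - l * \<tau>))"
    by (simp add: exp_diff exp_minus field_simps flip: ennreal_mult)
  finally show ?thesis
    unfolding eq E_def b_def by (simp add: mult_left_mono)
qed

lemma threshold_error_le:
  assumes j: "j < d" and \<alpha>: "0 < \<alpha>" "\<alpha> \<le> 1" and "0 < \<sigma>" "0 < a" "1 \<le> n"
    and \<theta>: "\<theta> j = 0 \<or> a \<le> \<theta> j"
    and \<mu>: "0 \<le> \<mu>" "\<mu> \<le> 1" "\<And>u. a / \<sigma> \<le> u \<Longrightarrow> \<mu> \<le> vote_bias \<alpha> u"
  shows "emeasure (vote_law \<sigma> n d \<alpha> \<theta>)
      {z \<in> space (RVs n d). threshold_selector n d \<mu> z j \<noteq> support_vec d \<theta> j} \<le>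
    ennreal (exp (- (real (n div d) * \<mu>\<^sup>2 / 16)))"
proof -
  let ?N = "real (card (group n d j))"
  let ?err = "{z \<in> space (RVs n d). threshold_selector n d \<mu> z j \<noteq> support_vec d \<theta> j}"
  \<comment> \<open>Without a signal the exponent per vote is l^2 - l \<mu> / 2, minimal at l =
    \<mu> / 4 with value - \<mu>^2 / 16. With a signal of bias at least \<mu>, the opposite
    \<open>l\<close> gives the same bound.\<close>
  define l where "l = (if \<theta> j = 0 then \<mu> / 4 else - \<mu> / 4)"
  let ?E = "{z \<in> space (RVs n d). 0 \<le> l * (votes n d j z - ?N * \<mu> / 2)}"
  have \<theta>0: "0 \<le> \<theta> j" using \<theta> \<open>0 < a\<close> by auto
  have kernels: "\<forall>i<n. randomized_response d \<alpha> (i mod d) \<in> RV d \<rightarrow>\<^sub>M prob_algebra (RV d)"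
    using j by (auto intro!: randomized_response_measurable)
  have sets: "sets (vote_law \<sigma> n d \<alpha> \<theta>) = sets (RVs n d)"
    by (rule sets_private_law[OF kernels \<open>1 \<le> n\<close> obs_law_in_prob_algebra])
  have [measurable]: "votes n d j \<in> borel_measurable (RVs n d)" by (rule votes_measurable[OF j])
  have "?E \<in> sets (RVs n d)" by measurable
  moreover have "?err \<subseteq> ?E"
    using j \<theta> \<mu>(1) \<open>0 < a\<close>
    by (auto simp: threshold_selector_def support_vec_def l_def mult_nonneg_nonneg mult_nonneg_nonpos split: if_splits)
  ultimately have "emeasure (vote_law \<sigma> n d \<alpha> \<theta>) ?err \<le> emeasure (vote_law \<sigma> n d \<alpha> \<theta>) ?E"
    by (intro emeasure_mono) (auto simp: sets)
  also have "\<dots> \<le> ennreal (exp (?N * (l * vote_bias \<alpha> (\<theta> j / \<sigma>) + l\<^sup>2) - l * (?N * \<mu> / 2)))"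
    using \<mu> assms \<theta>0 by (intro votes_chernoff) (auto simp: l_def)
  also have "\<dots> \<le> ennreal (exp (- (real (n div d) * \<mu>\<^sup>2 / 16)))"
  proof (intro ennreal_leI exp_le_cancel_iff[THEN iffD2])
    have "l * vote_bias \<alpha> (\<theta> j / \<sigma>) + l\<^sup>2 - l * \<mu> / 2 \<le> - (\<mu>\<^sup>2 / 16)"
    proof (cases "\<theta> j = 0")
      case True
      then show ?thesis by (simp add: l_def vote_bias_def power2_eq_square field_simps)
    next
      case False
      then have "a / \<sigma> \<le> \<theta> j / \<sigma>" using \<theta> \<open>0 < \<sigma>\<close> by (simp add: divide_right_mono)
      then have "\<mu> * \<mu> \<le> \<mu> * vote_bias \<alpha> (\<theta> j / \<sigma>)"
        using \<mu> by (intro mult_left_mono) auto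
      then show ?thesis using False by (simp add: l_def power2_eq_square field_simps)
    qed
    then have "?N * (l * vote_bias \<alpha> (\<theta> j / \<sigma>) + l\<^sup>2 - l * \<mu> / 2) \<le> ?N * - (\<mu>\<^sup>2 / 16)"
      by (intro mult_left_mono) auto
    moreover have "real (n div d) * (\<mu>\<^sup>2 / 16) \<le> ?N * (\<mu>\<^sup>2 / 16)"
      using card_group_ge[OF j, of n] by (intro mult_right_mono) auto
    ultimately show "?N * (l * vote_bias \<alpha> (\<theta> j / \<sigma>) + l\<^sup>2) - l * (?N * \<mu> / 2) \<le>
        - (real (n div d) * \<mu>\<^sup>2 / 16)"
      by (simp add: algebra_simps)
  qed
  finally show ?thesis .
qed

lemma threshold_risk_le:
  assumes \<alpha>: "0 < \<alpha>" "\<alpha> \<le> 1" and "0 < \<sigma>" "0 < a" "1 \<le> n" "1 \<le> d"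
    and \<theta>: "\<theta> \<in> Theta_plus d s a"
    and \<mu>: "0 \<le> \<mu>" "\<mu> \<le> 1" "\<And>u. a / \<sigma> \<le> u \<Longrightarrow> \<mu> \<le> vote_bias \<alpha> u"
  shows "risk \<nu> \<sigma> d n (\<lambda>i. randomized_response d \<alpha> (i mod d)) (threshold_selector n d \<mu>) \<theta> \<le>
    ennreal (real d * exp (- (real (n div d) * \<mu>\<^sup>2 / 16)))"
proof -
  have kernels: "\<forall>i<n. randomized_response d \<alpha> (i mod d) \<in> RV d \<rightarrow>\<^sub>M prob_algebra (RV d)"
    using \<open>1 \<le> d\<close> by (auto intro!: randomized_response_measurable)
  have *: "\<theta> j = 0 \<or> a \<le> \<theta> j" if "j < d" for j
    using \<theta> that by (auto simp: Theta_plus_def)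
  have "risk \<nu> \<sigma> d n (\<lambda>i. randomized_response d \<alpha> (i mod d)) (threshold_selector n d \<mu>) \<theta> =
    (\<Sum>j<d. emeasure (vote_law \<sigma> n d \<alpha> \<theta>)
      {z \<in> space (RVs n d). threshold_selector n d \<mu> z j \<noteq> support_vec d \<theta> j})"
    by (rule risk_eq_sum[OF kernels \<open>1 \<le> n\<close> threshold_selector_in_selectors])
  also have "\<dots> \<le> (\<Sum>j<d. ennreal (exp (- (real (n div d) * \<mu>\<^sup>2 / 16))))"
    using assms * by (intro sum_mono threshold_error_le[where a=a]) auto
  also have "\<dots> = ennreal (real d * exp (- (real (n div d) * \<mu>\<^sup>2 / 16)))"
    by (simp add: ennreal_mult ennreal_of_nat_eq_real_of_nat)
  finally show ?thesis .
qed

end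

text \<open>Rounding down loses less than 1, which is at most half of a quotient that is at least
  2.\<close>

lemma real_div_ge_half:
  fixes n d :: nat
  assumes "0 < d" "2 \<le> real n / real d"
  shows "real n / (2 * real d) \<le> real (n div d)"
proof -
  have "n < d + d * (n div d)" using assms by (intro dividend_less_times_div)
  then have "real n < real d + real d * real (n div d)"
    by (metis of_nat_add of_nat_less_iff of_nat_mult)
  then have "real n / real d \<le> 1 + real (n div d)"
    using assms by (simp add: field_simps)
  then show ?thesis using assms(2) by simp
qed

context noise
begin

text \<open>The target 2 ln d beats the union bound over d coordinates and leaves 1 / d. For
  \<open>t \<le> 1\<close> the hypothesis on \<open>t\<close> is used; beyond, where the bias has
  saturated, the second part of \<open>X\<close>. The number 1024 is 2 * 512, with 512 = 2 * 16 * 16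
  collecting the halved group size, the squared 1/4 in the bias and the Chernoff
  denominator.\<close>

lemma signal_suffices:
  fixes n d :: nat
  assumes "0 < \<kappa>" and \<alpha>: "0 < \<alpha>" "\<alpha> \<le> 1" and "1 < d"
    and X: "2 \<le> real n * \<alpha>\<^sup>2 / real d" "1024 / \<kappa>\<^sup>2 * ln (real d) \<le> real n * \<alpha>\<^sup>2 / real d"
    and t: "sqrt (1024 / \<kappa>\<^sup>2) * sqrt (real d * ln (real d) / (real n * \<alpha>\<^sup>2)) \<le> t"
  shows "2 * ln (real d) \<le> real (n div d) * (\<alpha> / 4 * (\<kappa> * min t 1))\<^sup>2 / 16"
proof -
  define X where "X = real n * \<alpha>\<^sup>2 / real d"
  have d: "0 < real d" "0 < ln (real d)" using \<open>1 < d\<close> by auto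
  have Xpos: "0 < X" using X(1) unfolding X_def by linarith
  have "0 \<le> sqrt (1024 / \<kappa>\<^sup>2) * sqrt (real d * ln (real d) / (real n * \<alpha>\<^sup>2))"
    using d by simp
  then have t0: "0 \<le> t" using t by linarith
  have "1024 / \<kappa>\<^sup>2 * ln (real d) \<le> X * (min t 1)\<^sup>2"
  proof (cases "t \<le> 1")
    case True
    have "real d * ln (real d) / (real n * \<alpha>\<^sup>2) = ln (real d) / X"
      using d by (simp add: X_def)
    then have "(sqrt (1024 / \<kappa>\<^sup>2) * sqrt (ln (real d) / X))\<^sup>2 \<le> t\<^sup>2"
      using t d Xpos by (intro power_mono) auto
    then have "1024 / \<kappa>\<^sup>2 * (ln (real d) / X) \<le> t\<^sup>2"
      using d Xpos by (simp add: power_mult_distrib)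
    then have "X * (1024 / \<kappa>\<^sup>2 * (ln (real d) / X)) \<le> X * t\<^sup>2"
      using Xpos by (intro mult_left_mono) auto
    then show ?thesis using Xpos True by simp
  next
    case False
    then show ?thesis using X(2) by (simp add: X_def)
  qed
  then have "\<kappa>\<^sup>2 / 512 * (1024 / \<kappa>\<^sup>2 * ln (real d)) \<le> \<kappa>\<^sup>2 / 512 * (X * (min t 1)\<^sup>2)"
    by (intro mult_left_mono) auto
  then have "2 * ln (real d) \<le> \<kappa>\<^sup>2 / 512 * (X * (min t 1)\<^sup>2)"
    using \<open>0 < \<kappa>\<close> by simp
  also have "\<dots> = real n / (2 * real d) * (\<alpha> / 4 * (\<kappa> * min t 1))\<^sup>2 / 16"
    by (simp add: X_def power_mult_distrib power_divide)
  also have "\<dots> \<le> real (n div d) * (\<alpha> / 4 * (\<kappa> * min t 1))\<^sup>2 / 16"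
  proof -
    have "\<alpha>\<^sup>2 \<le> 1" using \<alpha> by (simp add: power_le_one)
    then have "real n * \<alpha>\<^sup>2 / real d \<le> real n / real d"
      using d by (intro divide_right_mono mult_left_le) auto
    then have "real n / (2 * real d) \<le> real (n div d)"
      using X(1) \<open>1 < d\<close> by (intro real_div_ge_half) auto
    then show ?thesis by (intro divide_right_mono mult_right_mono) auto
  qed
  finally show ?thesis .
qed

lemma exact_recovery_possible_above_a_star:
  fixes \<alpha> :: "nat \<Rightarrow> real"
  assumes "0 < \<sigma>" and n: "\<forall>d\<ge>1. 1 \<le> n d" and \<alpha>: "\<forall>d\<ge>1. 0 < \<alpha> d \<and> \<alpha> d \<le> 1"
    and diverges: "filterlim (\<lambda>d. real (n d) * (\<alpha> d)\<^sup>2 / real d) at_top sequentially"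
    and signal: "dominates (\<lambda>d. real (n d) * (\<alpha> d)\<^sup>2 / real d) (\<lambda>d. ln (real d))"
    and a: "dominates a (a_star \<sigma> c_plus n \<alpha>)"
  shows "exact_recovery_possible \<nu> \<sigma> n s \<alpha> a"
proof -
  obtain \<kappa> where \<kappa>: "0 < \<kappa>" "\<And>u. 0 < u \<Longrightarrow> \<kappa> * min u 1 \<le> measure \<nu> {-u<..<u}"
    using interval_mass by blast
  define L where "L = L_const c_plus"
  have L: "0 < L" using c_plus_ge_half L_const_ge by (simp add: L_def)
  \<comment> \<open>The factor 16 * L cancels the one in \<open>a_star\<close>, so the domination
    hypothesis yields the signal strength required by \<open>signal_suffices\<close>.\<close>
  define B where "B = 16 * L * sqrt (1024 / \<kappa>\<^sup>2)"
  \<comment> \<open>Lower bound for the bias at the weakest admissible signal, from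
    \<open>interval_mass\<close>; it also holds for all stronger signals.\<close>
  define \<mu> where "\<mu> d = \<alpha> d / 4 * (\<kappa> * min (a d / \<sigma>) 1)" for d
  define Q where "Q d i = randomized_response d (\<alpha> d) (i mod d)" for d i
  define h where "h d = threshold_selector (n d) d (\<mu> d)" for d
  let ?risk = "\<lambda>d. SUP \<theta>\<in>Theta_plus d (s d) (a d). risk \<nu> \<sigma> d (n d) (Q d) (h d) \<theta>"
  have ev: "\<forall>\<^sub>F d in sequentially. 2 \<le> real (n d) * (\<alpha> d)\<^sup>2 / real d"
    "\<forall>\<^sub>F d in sequentially. 1024 / \<kappa>\<^sup>2 \<le> (real (n d) * (\<alpha> d)\<^sup>2 / real d) / ln (real d)"
    "\<forall>\<^sub>F d in sequentially. B \<le> a d / a_star \<sigma> c_plus n \<alpha> d"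
    using diverges signal a unfolding dominates_def filterlim_at_top by blast+
  have "\<forall>\<^sub>F d in sequentially. ?risk d \<le> ennreal (1 / real d)"
    using ev eventually_ge_at_top[of 2]
  proof eventually_elim
    case (elim d)
    have d: "1 \<le> d" "1 < d" "0 < real d" "0 < ln (real d)" using elim(4) by auto
    have \<alpha>d: "0 < \<alpha> d" "\<alpha> d \<le> 1" and nd: "1 \<le> n d" using \<alpha> n d by auto
    define r where "r = sqrt (real d * ln (real d) / (real (n d) * (\<alpha> d)\<^sup>2))"
    have r: "0 < r" using d \<alpha>d nd by (simp add: r_def)
    have astar: "a_star \<sigma> c_plus n \<alpha> d = \<sigma> / (16 * L) * r"
      by (simp add: a_star_def L_def r_def)
    then have "0 < a_star \<sigma> c_plus n \<alpha> d" using \<open>0 < \<sigma>\<close> L r by simp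
    then have "B * a_star \<sigma> c_plus n \<alpha> d \<le> a d"
      using elim(3) by (simp add: pos_le_divide_eq)
    then have "B * (\<sigma> / (16 * L) * r) \<le> a d" unfolding astar .
    then have t: "sqrt (1024 / \<kappa>\<^sup>2) * r \<le> a d / \<sigma>"
      using L \<open>0 < \<sigma>\<close> by (simp add: B_def field_simps)
    moreover have "0 < sqrt (1024 / \<kappa>\<^sup>2) * r" using \<kappa>(1) r by simp
    \<comment> \<open>Positivity of the signal is a consequence of dominating the positive
      \<open>a_star\<close>.\<close>
    ultimately have t0: "0 < a d / \<sigma>" by linarith
    then have a0: "0 < a d" using \<open>0 < \<sigma>\<close> by (simp add: zero_less_divide_iff)
    have "1024 / \<kappa>\<^sup>2 * ln (real d) \<le> real (n d) * (\<alpha> d)\<^sup>2 / real d"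
      using elim(2) unfolding pos_le_divide_eq[OF d(4)] .
    then have key: "2 * ln (real d) \<le> real (n d div d) * (\<mu> d)\<^sup>2 / 16"
      unfolding \<mu>_def using t elim(1) \<kappa>(1) \<alpha>d d by (intro signal_suffices) (auto simp: r_def)
    have \<mu>_le: "\<mu> d \<le> vote_bias (\<alpha> d) u" if "a d / \<sigma> \<le> u" for u
    proof -
      have "\<kappa> * min (a d / \<sigma>) 1 \<le> \<kappa> * min u 1"
        using that \<kappa>(1) by (intro mult_left_mono) auto
      also have "\<dots> \<le> measure \<nu> {-u<..<u}" using that t0 by (intro \<kappa>) auto
      finally show ?thesis unfolding \<mu>_def vote_bias_def using \<alpha>d by (intro mult_left_mono) auto
    qed
    have "\<kappa> * min (a d / \<sigma>) 1 \<le> 1"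
      using \<kappa>(2)[OF t0] prob_space.prob_le_1[OF prob_\<nu>] order_trans by blast
    then have "\<alpha> d / 4 * (\<kappa> * min (a d / \<sigma>) 1) \<le> 1 * 1"
      using \<alpha>d \<kappa>(1) t0 by (intro mult_mono) auto
    then have \<mu>01: "0 \<le> \<mu> d" "\<mu> d \<le> 1"
      using \<alpha>d \<kappa>(1) t0 by (auto simp: \<mu>_def)
    have "?risk d \<le> ennreal (real d * exp (- (real (n d div d) * (\<mu> d)\<^sup>2 / 16)))"
      unfolding Q_def h_def using \<mu>_le \<mu>01 \<alpha>d nd d a0 \<open>0 < \<sigma>\<close>
      by (intro SUP_least threshold_risk_le) auto
    also have "\<dots> \<le> ennreal (1 / real d)"
    proof (rule ennreal_leI)
      have "exp (- (real (n d div d) * (\<mu> d)\<^sup>2 / 16)) \<le> exp (- (ln (real d) + ln (real d)))"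
        using key by simp
      also have "\<dots> = 1 / (real d * real d)"
        unfolding exp_minus exp_add using d by (simp add: field_simps)
      finally have "real d * exp (- (real (n d div d) * (\<mu> d)\<^sup>2 / 16)) \<le> real d * (1 / (real d * real d))"
        by (intro mult_left_mono) auto
      then show "real d * exp (- (real (n d div d) * (\<mu> d)\<^sup>2 / 16)) \<le> 1 / real d"
        using d by simp
    qed
    finally show ?case .
  qed
  moreover have "(\<lambda>d. ennreal (1 / real d)) \<longlonglongrightarrow> ennreal 0"
    by (intro tendsto_ennrealI lim_1_over_n)
  ultimately have "?risk \<longlonglongrightarrow> 0"
    by (intro tendsto_sandwich[of "\<lambda>_. 0" ?risk sequentially "\<lambda>d. ennreal (1 / real d)"]) auto
  moreover have "Q d \<in> ldp_mechanisms d (n d) (\<alpha> d) \<and> h d \<in> selectors d (n d)" if "1 \<le> d" for d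
    using \<alpha> that unfolding Q_def h_def
    by (auto intro: randomized_response_ldp threshold_selector_in_selectors)
  ultimately show ?thesis
    unfolding exact_recovery_possible_def by blast
qed

end

section \<open>Log-concave noise and the recovery threshold\<close>

text \<open>A finite convex function on the whole line is continuous, which transfers to the
  density; positivity is read off its exponential form.\<close>

lemma noiseI:
  assumes "even_strongly_log_concave c p"
    and "curvature_le c_plus (\<lambda>x. - ln (p x))"
    and "\<nu> = density lborel (\<lambda>x. ennreal (p x))" "prob_space \<nu>"
    and "distr \<nu> borel uminus = \<nu>" "prob_space.variance \<nu> (\<lambda>x. x) = 1"
  shows "noise c_plus p \<nu>"
proof (rule noise.intro)
  obtain \<phi> where \<phi>: "convex_on UNIV \<phi>" "\<And>x. p x = exp (- \<phi> x) * exp (- c * x\<^sup>2 / 2)"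
    using assms(1) unfolding even_strongly_log_concave_def by auto
  then show "0 < p x" for x by simp
  have "continuous_on UNIV \<phi>" using \<phi>(1) by (intro convex_on_continuous) auto
  then have "continuous_on UNIV (\<lambda>x. exp (- \<phi> x) * exp (- c * x\<^sup>2 / 2))"
    by (intro continuous_intros) auto
  then show "continuous_on UNIV p" unfolding \<phi>(2)[symmetric] .
qed (rule assms)+

theorem corollary3p9:
  fixes c c_plus \<sigma> :: real and p :: "real \<Rightarrow> real" and \<nu> :: "real measure"
    and n s :: "nat \<Rightarrow> nat" and \<alpha> :: "nat \<Rightarrow> real"
  assumes "c > 0" and "c_plus > 0" and "\<sigma> > 0"
    and "even_strongly_log_concave c p"
    and "curvature_le c_plus (\<lambda>x. - ln (p x))"
    and "\<nu> = density lborel (\<lambda>x. ennreal (p x))"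
    and "prob_space \<nu>"
    and "distr \<nu> borel uminus = \<nu>"
    and "prob_space.variance \<nu> (\<lambda>x. x) = 1"
    and "\<forall>d\<ge>1. n d \<ge> 1"
    and "\<forall>d\<ge>1. 1 \<le> s d \<and> s d \<le> d"
    and "\<forall>d\<ge>1. 0 < \<alpha> d \<and> \<alpha> d \<le> 1"
    and "filterlim (\<lambda>d. real (n d) * (\<alpha> d)\<^sup>2 / real d) at_top sequentially"
    and "dominates (\<lambda>d. real (n d) * (\<alpha> d)\<^sup>2 / real d) (\<lambda>d. ln (real d))"
  shows "(\<forall>a. (\<forall>\<^sub>F d in sequentially. 0 < a d \<and> a d \<le> a_star \<sigma> c_plus n \<alpha> d) \<longrightarrow>
            exact_recovery_impossible \<nu> \<sigma> n s \<alpha> a) \<and>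
         (\<forall>a. dominates a (a_star \<sigma> c_plus n \<alpha>) \<longrightarrow>
            exact_recovery_possible \<nu> \<sigma> n s \<alpha> a)"
proof -
  interpret noise c_plus p \<nu>
    using assms(4-9) by (rule noiseI)
  show ?thesis
  proof (intro conjI allI impI)
    fix a :: "nat \<Rightarrow> real"
    show "exact_recovery_impossible \<nu> \<sigma> n s \<alpha> a"
      if "\<forall>\<^sub>F d in sequentially. 0 < a d \<and> a d \<le> a_star \<sigma> c_plus n \<alpha> d"
      using assms(11) by (intro exact_recovery_impossible_below_a_star assms(3,10,12,14) that) blast
    show "exact_recovery_possible \<nu> \<sigma> n s \<alpha> a" if "dominates a (a_star \<sigma> c_plus n \<alpha>)"
      by (rule exact_recovery_possible_above_a_star[OF assms(3,10,12-14) that])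
  qed
qed

end
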